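(* (Density Lemma.) Let $n\in\mathbb N$, let $\alpha$ be an s-tensor norm of order $n$ which is finitely generated or cofinitely generated, let $E$ be a normed space and $E_0$ a dense subspace of $E$. If $p$ is a continuous $n$-homogeneous polynomial on $E$ such that $$p|_{\otimes^{n,s}E_0}\in(\otimes^{n,s}_\alpha E_0)',$$ then $p\in(\otimes^{n,s}_\alpha E)'$ and $\|p\|_{(\otimes^{n,s}_\alpha E)'}=\|p\|_{(\otimes^{n,s}_\alpha E_0)'}$.
   Context: Normed spaces are over $\mathbb K=\mathbb R$ or $\mathbb C$. $FIN(E)$ is the set of finite dimensional subspaces of $E$, $COFIN(E)$ the set of closed finite codimensional subspaces, and for $L\in COFIN(E)$, $Q_L^E:E\to E/L$ is the canonical quotient map. $\otimes^{n,s}E$ is the linear span in $\otimes^nE$ of the elements $\otimes^n x=x\otimes\cdots\otimes x$, $x\in E$. For a continuous linear $T:E\to F$, $\otimes^{n,s}T:\otimes^{n,s}E\to\otimes^{n,s}F$ is the linear map with $\otimes^n x\mapsto\otimes^n(Tx)$. For $z\in\otimes^{n,s}E$: $\pi_s(z)=\inf\{\sum_j|\lambda_j|\|x_j\|^n\}$ over all representations $z=\sum_{j=1}^r\lambda_j\otimes^n x_j$, and $\varepsilon_s(z)=\sup_{x'\in B_{E'}}|\sum_j\lambda_j x'(x_j)^n|$ for any such representation. An s-tensor norm $\alpha$ of order $n$ assigns to each normed space $E$ a norm $\alpha(\,\cdot\,;\otimes^{n,s}E)$ on $\otimes^{n,s}E$ such that (1) $\varepsilon_s\le\alpha\le\pi_s$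 and (2) $\|\otimes^{n,s}T:\otimes^{n,s}_\alpha E\to\otimes^{n,s}_\alpha F\|\le\|T\|^n$ for every continuous linear $T:E\to F$; here $\otimes^{n,s}_\alpha E$ is $\otimes^{n,s}E$ with this norm. $\alpha$ is finitely generated if for every normed $E$ and $z\in\otimes^{n,s}E$, $\alpha(z;\otimes^{n,s}E)=\inf\{\alpha(z;\otimes^{n,s}M):M\in FIN(E),\ z\in\otimes^{n,s}M\}$. $\alpha$ is cofinitely generated if for every normed $E$ and $z\in\otimes^{n,s}E$, $\alpha(z;\otimes^{n,s}E)=\sup\{\alpha((\otimes^{n,s}Q_L^E)(z);\otimes^{n,s}E/L):L\in COFIN(E)\}$. A continuous $n$-homogeneous polynomial $p$ on $E$ ($p(x)=A(x,\dots,x)$ with $A$ continuous symmetric $n$-linear) is identified with the linear functional on $\otimes^{n,s}E$ given by $\otimes^n x\mapsto p(x)$; $p|_{\otimes^{n,s}E_0}$ is the restriction of this functional, and $p\in(\otimes^{n,s}_\alpha E)'$ means that the functional is $\alpha$-continuous, with $\|p\|_{(\otimes^{n,s}_\alpha E)'}$ its functional norm. *)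

theory Defs
  imports "HOL-Analysis.Analysis" "HOL-Library.Function_Algebras"
begin

text \<open>
  The scalar field. By Frobenius' theorem the only fields in this class are, up to isometric
  isomorphism, the real and the complex numbers; both are instances.
\<close>

class scalar_field = real_normed_field + euclidean_space

instance real :: scalar_field ..
instance complex :: scalar_field ..

section \<open>Normed spaces\<close>

text \<open>
  A normed space is a pair (\<open>V\<close>, \<open>N\<close>): \<open>V\<close> is a linear subspace of an
  ambient vector space (the type \<open>'v\<close> with scalar multiplication \<open>s\<close>), and
  \<open>N\<close> is a norm on \<open>V\<close>; the values of \<open>N\<close> outside \<open>V\<close> are irrelevant.
  The ambient space carries no norm and is arbitrary. It is the universe of
  the normed spaces under consideration: subspaces of a normed space in the universe are in the
  universe, and so are its quotients, see \<open>quot_space\<close> below.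
  The scalar multiplication is a parameter because the same notions are needed for spaces of
  tensors.
\<close>

definition normed_space :: "('k::real_normed_field \<Rightarrow> 'a::ab_group_add \<Rightarrow> 'a) \<Rightarrow> 'a set \<Rightarrow> ('a \<Rightarrow> real) \<Rightarrow> bool"
  where "normed_space s V N \<longleftrightarrow>
    module.subspace s V \<and>
    (\<forall>x\<in>V. N x \<ge> 0) \<and>
    (\<forall>x\<in>V. N x = 0 \<longleftrightarrow> x = 0) \<and>
    (\<forall>c. \<forall>x\<in>V. N (s c x) = norm c * N x) \<and>
    (\<forall>x\<in>V. \<forall>y\<in>V. N (x + y) \<le> N x + N y)"

text \<open>The case distinction only makes the distance a \<^const>\<open>Metric_space\<close> distance, whose
  nonnegativity and symmetry are required on the whole type.\<close>

definition norm_topology :: "'a::ab_group_add set \<Rightarrow> ('a \<Rightarrow> real) \<Rightarrow> 'a topology"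
  where "norm_topology V N =
    Metric_space.mtopology V (\<lambda>x y. if x \<in> V \<and> y \<in> V then N (x - y) else 0)"

definition linear_on ::
    "('k \<Rightarrow> 'a \<Rightarrow> 'a) \<Rightarrow> ('k \<Rightarrow> 'b \<Rightarrow> 'b) \<Rightarrow> 'a::ab_group_add set \<Rightarrow> ('a \<Rightarrow> 'b::ab_group_add) \<Rightarrow> bool"
  where "linear_on s1 s2 V f \<longleftrightarrow>
    (\<forall>x\<in>V. \<forall>y\<in>V. f (x + y) = f x + f y) \<and> (\<forall>c. \<forall>x\<in>V. f (s1 c x) = s2 c (f x))"

text \<open>A continuous linear map from (\<open>V\<close>, \<open>N\<close>) to (\<open>W\<close>, \<open>M\<close>); \<^const>\<open>continuous_map\<close> includes
  that it maps \<open>V\<close> into \<open>W\<close>.\<close>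

definition cont_linear ::
    "('k \<Rightarrow> 'a \<Rightarrow> 'a) \<Rightarrow> 'a::ab_group_add set \<Rightarrow> ('a \<Rightarrow> real) \<Rightarrow> 'a set \<Rightarrow> ('a \<Rightarrow> real) \<Rightarrow> ('a \<Rightarrow> 'a) \<Rightarrow> bool"
  where "cont_linear s V N W M T \<longleftrightarrow>
    linear_on s s V T \<and> continuous_map (norm_topology V N) (norm_topology W M) T"

definition in_dual ::
    "('k::real_normed_field \<Rightarrow> 'a::ab_group_add \<Rightarrow> 'a) \<Rightarrow> 'a set \<Rightarrow> ('a \<Rightarrow> real) \<Rightarrow> ('a \<Rightarrow> 'k) \<Rightarrow> bool"
  where "in_dual s V N f \<longleftrightarrow>
    linear_on s (*) V f \<and> continuous_map (norm_topology V N) euclidean f"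

text \<open>The norm of a continuous linear map; \<open>M\<close> is the norm of the codomain. For maps that are
  not bounded on the unit ball the value is meaningless.\<close>

definition op_norm :: "'a set \<Rightarrow> ('a \<Rightarrow> real) \<Rightarrow> ('b \<Rightarrow> real) \<Rightarrow> ('a \<Rightarrow> 'b) \<Rightarrow> real"
  where "op_norm V N M f = Sup {M (f x) | x. x \<in> V \<and> N x \<le> 1}"

section \<open>Finite-dimensional subspaces and quotients\<close>

definition finite_dim :: "('k::field \<Rightarrow> 'a::ab_group_add \<Rightarrow> 'a) \<Rightarrow> 'a set \<Rightarrow> bool"
  where "finite_dim s V \<longleftrightarrow> (\<exists>B. finite B \<and> module.span s B = V)"

definition FIN :: "('k::field \<Rightarrow> 'a::ab_group_add \<Rightarrow> 'a) \<Rightarrow> 'a set \<Rightarrow> 'a set set"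
  where "FIN s V = {M. module.subspace s M \<and> M \<subseteq> V \<and> finite_dim s M}"

text \<open>
  The quotient \<open>V / L\<close>. In order to remain inside the universe, it is realised on a
  linear system of coset representatives, i.e. on a (chosen) algebraic complement of \<open>L\<close> in
  \<open>V\<close>: a representative stands for its coset, so that the quotient map sends \<open>x\<close> to
  the representative of \<open>x + L\<close>, and the quotient norm is the infimum of the norm over
  the coset. This is linearly isometric to the space of cosets.
\<close>

definition quot_space :: "('k::field \<Rightarrow> 'a::ab_group_add \<Rightarrow> 'a) \<Rightarrow> 'a set \<Rightarrow> 'a set \<Rightarrow> 'a set"
  where "quot_space s V L = (SOME C. module.subspace s C \<and> C \<subseteq> V \<and> C \<inter> L = {0} \<and>
    (\<forall>x\<in>V. \<exists>c\<in>C. x - c \<in> L))"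

definition quot_map :: "('k::field \<Rightarrow> 'a::ab_group_add \<Rightarrow> 'a) \<Rightarrow> 'a set \<Rightarrow> 'a set \<Rightarrow> 'a \<Rightarrow> 'a"
  where "quot_map s V L x = (THE c. c \<in> quot_space s V L \<and> x - c \<in> L)"

definition quot_norm :: "('a::ab_group_add \<Rightarrow> real) \<Rightarrow> 'a set \<Rightarrow> 'a \<Rightarrow> real"
  where "quot_norm N L c = Inf {N (c + l) | l. l \<in> L}"

definition COFIN :: "('k::field \<Rightarrow> 'a::ab_group_add \<Rightarrow> 'a) \<Rightarrow> 'a set \<Rightarrow> ('a \<Rightarrow> real) \<Rightarrow> 'a set set"
  where "COFIN s V N = {L. module.subspace s L \<and> L \<subseteq> V \<and>
    closedin (norm_topology V N) L \<and> finite_dim s (quot_space s V L)}"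

section \<open>Multilinear forms and polynomials\<close>

text \<open>\<open>n\<close>-tuples are functions on \<open>{..<n}\<close>.\<close>

definition multilinear_on ::
    "('k::real_normed_field \<Rightarrow> 'a::ab_group_add \<Rightarrow> 'a) \<Rightarrow> nat \<Rightarrow> 'a set \<Rightarrow> ((nat \<Rightarrow> 'a) \<Rightarrow> 'k) \<Rightarrow> bool"
  where "multilinear_on s n V A \<longleftrightarrow>
    (\<forall>x \<in> {..<n} \<rightarrow>\<^sub>E V. \<forall>i<n. linear_on s (*) V (\<lambda>v. A (x(i := v))))"

definition symmetric_on :: "nat \<Rightarrow> 'a set \<Rightarrow> ((nat \<Rightarrow> 'a) \<Rightarrow> 'k) \<Rightarrow> bool"
  where "symmetric_on n V A \<longleftrightarrow>
    (\<forall>\<sigma>. \<sigma> permutes {..<n} \<longrightarrow> (\<forall>x \<in> {..<n} \<rightarrow>\<^sub>E V. A (x \<circ> \<sigma>) = A x))"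

definition diag :: "nat \<Rightarrow> 'a \<Rightarrow> nat \<Rightarrow> 'a"
  where "diag n x = (\<lambda>i\<in>{..<n}. x)"

definition cont_hom_poly ::
    "('k::real_normed_field \<Rightarrow> 'a::ab_group_add \<Rightarrow> 'a) \<Rightarrow> nat \<Rightarrow> 'a set \<Rightarrow> ('a \<Rightarrow> real) \<Rightarrow> ('a \<Rightarrow> 'k) \<Rightarrow> bool"
  where "cont_hom_poly s n V N p \<longleftrightarrow>
    (\<exists>A. multilinear_on s n V A \<and> symmetric_on n V A \<and>
      continuous_map (product_topology (\<lambda>_. norm_topology V N) {..<n}) euclidean A \<and>
      (\<forall>x\<in>V. p x = A (diag n x)))"

section \<open>Symmetric tensors\<close>

text \<open>
  The \<open>n\<close>-th tensor power of the ambient space is realised inside the algebraic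
  dual of the space of \<open>n\<close>-linear forms: the elementary tensor of
  \<open>x\<close> is evaluation of forms at \<open>x\<close> (and is 0 on functions that are not \<open>n\<close>-linear forms).
  For a subspace \<open>V\<close> of the ambient space, the tensor power of \<open>V\<close> is a subspace of that of the
  ambient space, because every \<open>n\<close>-linear form on \<open>V\<close> extends to the ambient space.
\<close>

type_synonym ('v, 'k) tensor = "((nat \<Rightarrow> 'v) \<Rightarrow> 'k) \<Rightarrow> 'k"

definition tscale :: "'k::real_normed_field \<Rightarrow> ('v, 'k) tensor \<Rightarrow> ('v, 'k) tensor"
  where "tscale c z = (\<lambda>A. c * z A)"

definition elem_tensor ::
    "('k::real_normed_field \<Rightarrow> 'v::ab_group_add \<Rightarrow> 'v) \<Rightarrow> nat \<Rightarrow> (nat \<Rightarrow> 'v) \<Rightarrow> ('v, 'k) tensor"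
  where "elem_tensor s n x = (\<lambda>A. if multilinear_on s n UNIV A then A x else 0)"

definition tpow ::
    "('k::real_normed_field \<Rightarrow> 'v::ab_group_add \<Rightarrow> 'v) \<Rightarrow> nat \<Rightarrow> 'v \<Rightarrow> ('v, 'k) tensor"
  where "tpow s n x = elem_tensor s n (diag n x)"

definition sym_tensors ::
    "('k::real_normed_field \<Rightarrow> 'v::ab_group_add \<Rightarrow> 'v) \<Rightarrow> nat \<Rightarrow> 'v set \<Rightarrow> ('v, 'k) tensor set"
  where "sym_tensors s n V = module.span tscale (tpow s n ` V)"

definition is_rep ::
    "('k::real_normed_field \<Rightarrow> 'v::ab_group_add \<Rightarrow> 'v) \<Rightarrow> nat \<Rightarrow> 'v set \<Rightarrow> ('v, 'k) tensor \<Rightarrow>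
      nat \<Rightarrow> (nat \<Rightarrow> 'k) \<Rightarrow> (nat \<Rightarrow> 'v) \<Rightarrow> bool"
  where "is_rep s n V z r c x \<longleftrightarrow>
    (\<forall>j<r. x j \<in> V) \<and> z = (\<Sum>j<r. tscale (c j) (tpow s n (x j)))"

text \<open>
  The value at \<open>z\<close> of the linear map on \<open>sym_tensors s n V\<close> that sends \<open>tpow s n x\<close> to \<open>f x\<close>,
  for \<open>x\<close> in \<open>V\<close>; \<open>s2\<close> is the scalar multiplication of the codomain. It exists in the two cases
  in which it is used, namely for the \<open>n\<close>-th tensor power of a linear map and for
  \<open>n\<close>-homogeneous polynomials.
\<close>

definition sym_lin ::
    "('k::real_normed_field \<Rightarrow> 'v::ab_group_add \<Rightarrow> 'v) \<Rightarrow> ('k \<Rightarrow> 'b \<Rightarrow> 'b) \<Rightarrow> nat \<Rightarrow> 'v set \<Rightarrow>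
      ('v \<Rightarrow> 'b::ab_group_add) \<Rightarrow> ('v, 'k) tensor \<Rightarrow> 'b"
  where "sym_lin s s2 n V f z =
    (THE w. \<exists>r c x. is_rep s n V z r c x \<and> w = (\<Sum>j<r. s2 (c j) (f (x j))))"

definition sym_map ::
    "('k::real_normed_field \<Rightarrow> 'v::ab_group_add \<Rightarrow> 'v) \<Rightarrow> nat \<Rightarrow> 'v set \<Rightarrow> ('v \<Rightarrow> 'v) \<Rightarrow>
      ('v, 'k) tensor \<Rightarrow> ('v, 'k) tensor"
  where "sym_map s n V T = sym_lin s tscale n V (\<lambda>x. tpow s n (T x))"

definition poly_functional ::
    "('k::real_normed_field \<Rightarrow> 'v::ab_group_add \<Rightarrow> 'v) \<Rightarrow> nat \<Rightarrow> 'v set \<Rightarrow> ('v \<Rightarrow> 'k) \<Rightarrow>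
      ('v, 'k) tensor \<Rightarrow> 'k"
  where "poly_functional s n V p = sym_lin s (*) n V p"

definition pi_s ::
    "('k::real_normed_field \<Rightarrow> 'v::ab_group_add \<Rightarrow> 'v) \<Rightarrow> nat \<Rightarrow> 'v set \<Rightarrow> ('v \<Rightarrow> real) \<Rightarrow>
      ('v, 'k) tensor \<Rightarrow> real"
  where "pi_s s n V N z = Inf {\<Sum>j<r. norm (c j) * N (x j) ^ n | r c x. is_rep s n V z r c x}"

definition eps_s ::
    "('k::real_normed_field \<Rightarrow> 'v::ab_group_add \<Rightarrow> 'v) \<Rightarrow> nat \<Rightarrow> 'v set \<Rightarrow> ('v \<Rightarrow> real) \<Rightarrow>
      ('v, 'k) tensor \<Rightarrow> real"
  where "eps_s s n V N z =
    Sup {norm (poly_functional s n V (\<lambda>x. f x ^ n) z) | f. in_dual s V N f \<and> op_norm V N norm f \<le> 1}"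

section \<open>S-tensor norms\<close>

text \<open>\<open>\<alpha> V N\<close> is the norm that \<open>\<alpha>\<close> assigns to the normed space (\<open>V\<close>, \<open>N\<close>). Applied to an identity
  map, the metric mapping property shows that it depends on \<open>N\<close> only through its values on \<open>V\<close>.\<close>

type_synonym ('v, 'k) norm_assignment = "'v set \<Rightarrow> ('v \<Rightarrow> real) \<Rightarrow> ('v, 'k) tensor \<Rightarrow> real"

definition s_tensor_norm ::
    "('k::real_normed_field \<Rightarrow> 'v::ab_group_add \<Rightarrow> 'v) \<Rightarrow> nat \<Rightarrow> ('v, 'k) norm_assignment \<Rightarrow> bool"
  where "s_tensor_norm s n \<alpha> \<longleftrightarrow>
    (\<forall>V N. normed_space s V N \<longrightarrow>
      normed_space tscale (sym_tensors s n V) (\<alpha> V N) \<and>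
      (\<forall>z \<in> sym_tensors s n V. eps_s s n V N z \<le> \<alpha> V N z \<and> \<alpha> V N z \<le> pi_s s n V N z)) \<and>
    (\<forall>V N W M T. normed_space s V N \<longrightarrow> normed_space s W M \<longrightarrow> cont_linear s V N W M T \<longrightarrow>
      cont_linear tscale (sym_tensors s n V) (\<alpha> V N) (sym_tensors s n W) (\<alpha> W M) (sym_map s n V T) \<and>
      op_norm (sym_tensors s n V) (\<alpha> V N) (\<alpha> W M) (sym_map s n V T) \<le> op_norm V N M T ^ n)"

definition finitely_generated ::
    "('k::real_normed_field \<Rightarrow> 'v::ab_group_add \<Rightarrow> 'v) \<Rightarrow> nat \<Rightarrow> ('v, 'k) norm_assignment \<Rightarrow> bool"
  where "finitely_generated s n \<alpha> \<longleftrightarrow>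
    (\<forall>V N. normed_space s V N \<longrightarrow> (\<forall>z \<in> sym_tensors s n V.
      \<alpha> V N z = Inf {\<alpha> M N z | M. M \<in> FIN s V \<and> z \<in> sym_tensors s n M}))"

definition cofinitely_generated ::
    "('k::real_normed_field \<Rightarrow> 'v::ab_group_add \<Rightarrow> 'v) \<Rightarrow> nat \<Rightarrow> ('v, 'k) norm_assignment \<Rightarrow> bool"
  where "cofinitely_generated s n \<alpha> \<longleftrightarrow>
    (\<forall>V N. normed_space s V N \<longrightarrow> (\<forall>z \<in> sym_tensors s n V.
      \<alpha> V N z = Sup {\<alpha> (quot_space s V L) (quot_norm N L) (sym_map s n V (quot_map s V L) z) | L.
        L \<in> COFIN s V N}))"

end

theory Submission
  imports Defs
begin

text \<open>
  Let \<open>\<phi>\<close> be the functional of \<open>p\<close> and \<open>K\<close> its norm on the tensors over the dense subspace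
  \<open>D\<close>. What has to be shown is \<open>|\<phi> z| \<le> K \<alpha> E N z\<close> for every symmetric tensor \<open>z\<close> over \<open>E\<close>; the
  opposite inequality of the norms comes from \<open>\<alpha> E N \<le> \<alpha> D N\<close> on tensors over \<open>D\<close>, which is
  the mapping property of the inclusion. The two kinds of \<open>\<alpha>\<close> need different arguments, as they
  allow access to \<open>\<alpha> E N\<close> from opposite sides.

  If \<open>\<alpha>\<close> is finitely generated, it is enough to bound \<open>\<phi> z\<close> by \<open>K \<alpha> M N z\<close> for a tensor \<open>z\<close> over a
  finite-dimensional \<open>M\<close>. The coordinates on \<open>M\<close> are bounded, so moving the vectors of a basis slightly
  gives linear maps \<open>R\<close> from \<open>M\<close> into \<open>D\<close> as close to the identity as desired
  (\<open>push_into_dense_subspace\<close>). The image of \<open>z\<close> under the tensor power of \<open>R\<close> is a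
  tensor over \<open>D\<close> whose norm exceeds \<open>\<alpha> M N z\<close> by at most the factor \<open>\<parallel>R\<parallel> ^ n\<close>, and the value of \<open>\<phi>\<close>
  there tends to \<open>\<phi> z\<close> by the continuity of \<open>p\<close> (\<open>bound_of_finite_dim\<close>).

  If \<open>\<alpha>\<close> is cofinitely generated, then \<open>\<alpha> D N\<close> and \<open>\<alpha> E N\<close> agree on tensors over \<open>D\<close>: a quotient map
  from \<open>D\<close> onto a finite-dimensional \<open>D / L\<close> is a contraction into a complete space, so it extends to a
  contraction on \<open>E\<close> (\<open>extend_contraction\<close>), and the mapping property of the extension bounds each term of
  the supremum that defines \<open>\<alpha> D N\<close> (\<open>cofinitely_generated_dense_le\<close>). This gives the bound for tensors
  over \<open>D\<close>. It passes to tensors over \<open>E\<close> because these are limits of tensors over \<open>D\<close>: the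
  \<open>n\<close>-th tensor power is a continuous map into the tensors normed by \<open>\<alpha>\<close>
  (\<open>s_tensor_norm_tpow_tendsto\<close>), by \<open>\<alpha> \<le> \<pi>\<^sub>s\<close> and Lagrange interpolation along a line.
\<close>

section \<open>Normed spaces, bounded linear maps and density\<close>

locale normed_vs = vector_space s
  for s :: "'k::real_normed_field \<Rightarrow> 'a::ab_group_add \<Rightarrow> 'a" +
  fixes V :: "'a set" and N :: "'a \<Rightarrow> real"
  assumes normed: "normed_space s V N"
begin

lemma sub: "subspace V"
  using normed by (simp add: normed_space_def)

lemma mem [simp]: "0 \<in> V" "x \<in> V \<Longrightarrow> s c x \<in> V" "x \<in> V \<Longrightarrow> y \<in> V \<Longrightarrow> x + y \<in> V"
    "x \<in> V \<Longrightarrow> y \<in> V \<Longrightarrow> x - y \<in> V" "x \<in> V \<Longrightarrow> - x \<in> V"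
  using sub by (auto intro: subspace_0 subspace_scale subspace_add subspace_diff subspace_neg)

lemma nrm_nonneg [simp]: "x \<in> V \<Longrightarrow> 0 \<le> N x"
  using normed by (auto simp: normed_space_def)

lemma nrm_eq_0: "x \<in> V \<Longrightarrow> N x = 0 \<longleftrightarrow> x = 0"
  using normed by (auto simp: normed_space_def)

lemma nrm_scale: "x \<in> V \<Longrightarrow> N (s c x) = norm c * N x"
  using normed by (auto simp: normed_space_def)

lemma nrm_add: "x \<in> V \<Longrightarrow> y \<in> V \<Longrightarrow> N (x + y) \<le> N x + N y"
  using normed by (auto simp: normed_space_def)

lemma nrm_0 [simp]: "N 0 = 0"
  using nrm_eq_0[of 0] by simp

lemma nrm_minus: "x \<in> V \<Longrightarrow> N (- x) = N x"
  using nrm_scale[of x "- 1"] by simp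

lemma nrm_commute: "x \<in> V \<Longrightarrow> y \<in> V \<Longrightarrow> N (x - y) = N (y - x)"
  using nrm_minus[of "x - y"] by simp

lemma nrm_triangle: "x \<in> V \<Longrightarrow> y \<in> V \<Longrightarrow> z \<in> V \<Longrightarrow> N (x - z) \<le> N (x - y) + N (y - z)"
proof -
  assume "x\<in>V" "y\<in>V" "z\<in>V"
  then have "x - y \<in> V" "y - z \<in> V" by auto
  from nrm_add[OF this] show ?thesis by simp
qed

lemma nrm_le_diff: "x \<in> V \<Longrightarrow> y \<in> V \<Longrightarrow> N x \<le> N y + N (x - y)"
  using nrm_triangle[of x y 0] by (simp add: add.commute)

lemma nrm_sum: "(\<And>i. i \<in> I \<Longrightarrow> f i \<in> V) \<Longrightarrow> N (sum f I) \<le> (\<Sum>i\<in>I. N (f i))"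
proof (induction I rule: infinite_finite_induct)
  case (insert i I)
  have "sum f I \<in> V"
    using insert.prems by (intro subspace_sum[OF sub]) auto
  have "f i \<in> V"
    using insert.prems by auto
  show ?case
    using insert nrm_add[OF \<open>f i \<in> V\<close> \<open>sum f I \<in> V\<close>] by (simp add: order_trans add_mono)
qed simp_all

lemma normed_subspace: "subspace M \<Longrightarrow> M \<subseteq> V \<Longrightarrow> normed_space s M N"
  using normed by (simp add: normed_space_def subset_iff)

lemma metric: "Metric_space V (\<lambda>x y. if x \<in> V \<and> y \<in> V then N (x - y) else 0)"
  by unfold_locales (use nrm_commute nrm_eq_0 nrm_triangle in auto)

lemma topspace_norm_topology [simp]: "topspace (norm_topology V N) = V"
  by (simp add: norm_topology_def Metric_space.topspace_mtopology[OF metric])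

lemma dense_iff:
  "norm_topology V N closure_of S = V \<longleftrightarrow> (\<forall>x\<in>V. \<forall>e>0. \<exists>y\<in>S \<inter> V. N (x - y) < e)"
proof -
  let ?d = "\<lambda>x y. if x \<in> V \<and> y \<in> V then N (x - y) else 0"
  have "y \<in> Metric_space.mball V ?d x e \<longleftrightarrow> x \<in> V \<and> y \<in> V \<and> N (x - y) < e" for x y e
    unfolding Metric_space.in_mball[OF metric] by auto
  then show ?thesis
    unfolding norm_topology_def Metric_space.metric_closure_of[OF metric] by (simp add: set_eq_iff) blast
qed

lemma closed_imp_distance:
  assumes "closedin (norm_topology V N) L" "x \<in> V" "x \<notin> L"
  obtains r where "r > 0" "\<And>y. y \<in> L \<Longrightarrow> N (x - y) \<ge> r"
proof -
  have "L \<subseteq> V" "\<exists>r>0. disjnt L (Metric_space.mball V (\<lambda>x y. if x \<in> V \<and> y \<in> V then N (x - y) else 0) x r)"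
    using assms unfolding norm_topology_def Metric_space.closedin_metric[OF metric] by auto
  then obtain r where r: "r > 0" "\<And>y. y \<in> L \<Longrightarrow> y \<in> V \<and>
      y \<notin> Metric_space.mball V (\<lambda>x y. if x \<in> V \<and> y \<in> V then N (x - y) else 0) x r"
    by (auto simp: disjnt_iff)
  show ?thesis
    by (rule that[OF r(1)]) (use r(2) assms in \<open>force simp: Metric_space.in_mball[OF metric]\<close>)
qed

end

lemma normed_vs_scalars: "normed_vs (*) UNIV (norm :: 'k::real_normed_field \<Rightarrow> real)"
  by (intro normed_vs.intro normed_vs_axioms.intro vector_space_over_itself.vector_space_axioms)
    (simp add: normed_space_def norm_mult norm_triangle_ineq vector_space_over_itself.subspace_UNIV)

lemma norm_topology_scalars: "norm_topology UNIV (norm :: 'k::real_normed_field \<Rightarrow> real) = euclidean"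
proof -
  have "(\<lambda>x y :: 'k. if x \<in> UNIV \<and> y \<in> UNIV then norm (x - y) else 0) = dist"
    by (simp add: dist_norm fun_eq_iff)
  then show ?thesis
    by (simp only: norm_topology_def mtopology_is_euclidean)
qed

lemma continuous_map_norm_topology:
  assumes "normed_vs s V N" "normed_vs s' W M"
  shows "continuous_map (norm_topology V N) (norm_topology W M) f \<longleftrightarrow>
    f \<in> V \<rightarrow> W \<and> (\<forall>x\<in>V. \<forall>e>0. \<exists>d>0. \<forall>y\<in>V. N (x - y) < d \<longrightarrow> M (f x - f y) < e)"
proof -
  have *: "(\<forall>x. x \<in> V \<and> (if a \<in> V \<and> x \<in> V then N (a - x) else 0) < d \<longrightarrow>
      (if f a \<in> W \<and> f x \<in> W then M (f a - f x) else 0) < e) \<longleftrightarrow>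
      (\<forall>y\<in>V. N (a - y) < d \<longrightarrow> M (f a - f y) < e)"
    if "a \<in> V" "f ` V \<subseteq> W" for a d e
    using that by (auto simp: image_subset_iff)
  show ?thesis
    unfolding norm_topology_def Metric_space.metric_continuous_map
        [OF normed_vs.metric[OF assms(1)] normed_vs.metric[OF assms(2)]] image_subset_iff_funcset[symmetric]
    by (intro conj_cong refl ball_cong all_cong imp_cong ex_cong) (rule *)
qed

lemma linear_on_0:
  assumes "vector_space s" "vector_space s'" "linear_on s s' V f" "0 \<in> V"
  shows "f 0 = 0"
proof -
  interpret A: vector_space s by fact
  interpret B: vector_space s' by fact
  have "f (s 0 0) = s' 0 (f 0)"
    using assms by (simp only: linear_on_def)
  then show ?thesis by simp
qed

lemma linear_on_diff:
  assumes "vector_space s" "vector_space s'" "linear_on s s' V f" "x \<in> V" "y \<in> V" "s (- 1) y \<in> V"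
  shows "f (x - y) = f x - f y"
proof -
  interpret A: vector_space s by fact
  interpret B: vector_space s' by fact
  have "f (x + s (- 1) y) = f x + s' (- 1) (f y)"
    using assms by (simp only: linear_on_def)
  then show ?thesis by simp
qed

text \<open>The domain and the codomain may be normed over different ambient spaces, and with
  \<^const>\<open>norm\<close> on the scalars as the codomain this is also the criterion for \<^const>\<open>in_dual\<close>.\<close>

lemma bounded_linear_on_iff:
  fixes s :: "'k::real_normed_field \<Rightarrow> 'a::ab_group_add \<Rightarrow> 'a"
    and s' :: "'k \<Rightarrow> 'b::ab_group_add \<Rightarrow> 'b"
  assumes "normed_vs s V N" "normed_vs s' W M" "linear_on s s' V f" "f \<in> V \<rightarrow> W"
  shows "continuous_map (norm_topology V N) (norm_topology W M) f \<longleftrightarrow>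
    (\<exists>C\<ge>0. \<forall>x\<in>V. M (f x) \<le> C * N x)"
proof -
  interpret A: normed_vs s V N by fact
  interpret B: normed_vs s' W M by fact
  have f0: "f 0 = 0"
    by (rule linear_on_0[OF _ _ assms(3)]) (auto intro: A.vector_space_axioms B.vector_space_axioms)
  have fd: "f (x - y) = f x - f y" if "x \<in> V" "y \<in> V" for x y
    by (rule linear_on_diff[OF _ _ assms(3)])
      (use that in \<open>auto intro: A.vector_space_axioms B.vector_space_axioms\<close>)
  have fs: "f (s c x) = s' c (f x)" if "x \<in> V" for c x
    using assms(3) that by (simp add: linear_on_def)
  show ?thesis
  proof
    assume "continuous_map (norm_topology V N) (norm_topology W M) f"
    then have "\<forall>x\<in>V. \<forall>e>0. \<exists>d>0. \<forall>y\<in>V. N (x - y) < d \<longrightarrow> M (f x - f y) < e"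
      using continuous_map_norm_topology[OF assms(1,2)] by blast
    from this[rule_format, of 0 1] obtain d where "d > 0"
      and "\<forall>y\<in>V. N (0 - y) < d \<longrightarrow> M (f 0 - f y) < 1"
      by (meson A.mem(1) zero_less_one)
    then have d: "M (f y) < 1" if "y \<in> V" "N y < d" for y
      using that assms(4) by (auto simp: f0 A.nrm_minus B.nrm_minus Pi_iff)
    have "M (f x) \<le> 2 / d * N x" if x: "x \<in> V" for x
    proof (cases "x = 0")
      case False
      then have pos: "N x > 0"
        using A.nrm_eq_0[OF x] A.nrm_nonneg[OF x] by linarith
      define c :: 'k where "c = of_real (d / (2 * N x))"
      have c: "norm c = d / (2 * N x)"
        using pos \<open>d > 0\<close> by (simp add: c_def del: of_real_divide of_real_mult)
      have "N (s c x) < d"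
        using pos \<open>d > 0\<close> by (simp add: A.nrm_scale x c)
      then have "M (f (s c x)) < 1"
        using d x by simp
      then have "norm c * M (f x) < 1"
        using x assms(4) by (auto simp: fs B.nrm_scale Pi_iff)
      then show ?thesis
        using pos \<open>d > 0\<close> by (simp add: c field_simps)
    qed (simp add: f0)
    then show "\<exists>C\<ge>0. \<forall>x\<in>V. M (f x) \<le> C * N x"
      using \<open>d > 0\<close> by (intro exI[of _ "2 / d"]) auto
  next
    assume "\<exists>C\<ge>0. \<forall>x\<in>V. M (f x) \<le> C * N x"
    then obtain C where C: "C \<ge> 0" "\<And>x. x \<in> V \<Longrightarrow> M (f x) \<le> C * N x"
      by auto
    have "\<exists>d>0. \<forall>y\<in>V. N (x - y) < d \<longrightarrow> M (f x - f y) < e" if "x \<in> V" "e > 0" for x e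
    proof (intro exI[of _ "e / (C + 1)"] conjI ballI impI)
      show "e / (C + 1) > 0"
        using that C by simp
      fix y assume y: "y \<in> V" "N (x - y) < e / (C + 1)"
      have "M (f x - f y) \<le> C * N (x - y)"
        using C(2)[of "x - y"] that y by (simp add: fd)
      also have "\<dots> \<le> (C + 1) * N (x - y)"
        using that y by (simp add: algebra_simps)
      also have "\<dots> < e"
        using y C by (simp add: field_simps)
      finally show "M (f x - f y) < e" .
    qed
    then show "continuous_map (norm_topology V N) (norm_topology W M) f"
      using assms continuous_map_norm_topology[OF assms(1,2)] by blast
  qed
qed

lemma op_norm_le:
  assumes "0 \<in> V" "N 0 \<le> 1" "\<And>x. x \<in> V \<Longrightarrow> M (f x) \<le> C * N x" "C \<ge> 0"
  shows "op_norm V N M f \<le> C"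
  unfolding op_norm_def
proof (rule cSup_least)
  show "{M (f x) |x. x \<in> V \<and> N x \<le> 1} \<noteq> {}"
    using assms(1,2) by blast
  fix r assume "r \<in> {M (f x) |x. x \<in> V \<and> N x \<le> 1}"
  then obtain x where x: "r = M (f x)" "x \<in> V" "N x \<le> 1"
    by blast
  then have "C * N x \<le> C * 1"
    using assms(4) by (intro mult_left_mono)
  then show "r \<le> C"
    using assms(3)[of x] x by simp
qed

text \<open>The value \<^const>\<open>op_norm\<close> is a supremum of reals, and so it is a bound only if the values on
  the unit ball are bounded; continuity provides that.\<close>

lemma op_norm_bound:
  fixes s :: "'k::real_normed_field \<Rightarrow> 'a::ab_group_add \<Rightarrow> 'a"
    and s' :: "'k \<Rightarrow> 'b::ab_group_add \<Rightarrow> 'b"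
  assumes "normed_vs s V N" "normed_vs s' W M" "linear_on s s' V f"
    and cont: "continuous_map (norm_topology V N) (norm_topology W M) f"
  shows "op_norm V N M f \<ge> 0" "x \<in> V \<Longrightarrow> M (f x) \<le> op_norm V N M f * N x"
proof -
  interpret A: normed_vs s V N by fact
  interpret B: normed_vs s' W M by fact
  have fV: "f \<in> V \<rightarrow> W"
    using cont continuous_map_norm_topology[OF assms(1,2)] by blast
  obtain C where C: "C \<ge> 0" "\<And>x. x \<in> V \<Longrightarrow> M (f x) \<le> C * N x"
    using bounded_linear_on_iff[OF assms(1-3) fV] cont by blast
  have bdd: "bdd_above {M (f x) |x. x \<in> V \<and> N x \<le> 1}"
  proof (rule bdd_aboveI)
    fix r assume "r \<in> {M (f x) |x. x \<in> V \<and> N x \<le> 1}"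
    then obtain x where x: "r = M (f x)" "x \<in> V" "N x \<le> 1"
      by blast
    then have "C * N x \<le> C * 1"
      using C(1) by (intro mult_left_mono)
    then show "r \<le> C"
      using C(2)[of x] x by simp
  qed
  have up: "M (f x) \<le> op_norm V N M f" if "x \<in> V" "N x \<le> 1" for x
    unfolding op_norm_def by (rule cSup_upper[OF _ bdd]) (use that in blast)
  have f0: "f 0 = 0"
    by (rule linear_on_0[OF _ _ assms(3)]) (auto intro: A.vector_space_axioms B.vector_space_axioms)
  show "op_norm V N M f \<ge> 0"
    using up[of 0] by (simp add: f0)
  show "M (f x) \<le> op_norm V N M f * N x" if x: "x \<in> V"
  proof (cases "x = 0")
    case False
    then have pos: "N x > 0"
      using A.nrm_eq_0[OF x] A.nrm_nonneg[OF x] by linarith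
    define c :: 'k where "c = of_real (1 / N x)"
    have c: "norm c = 1 / N x"
      using pos by (simp add: c_def del: of_real_divide)
    have "M (f (s c x)) \<le> op_norm V N M f"
      using pos by (intro up) (simp_all add: A.nrm_scale x c)
    moreover have "M (f (s c x)) = M (f x) / N x"
      using assms(3) x fV by (auto simp: linear_on_def B.nrm_scale c Pi_iff)
    ultimately show ?thesis
      using pos by (simp add: field_simps)
  qed (simp add: f0)
qed

lemma cont_linearI:
  assumes "normed_vs s V N" "normed_vs s W M" "linear_on s s V T" "T \<in> V \<rightarrow> W"
    "C \<ge> 0" "\<And>x. x \<in> V \<Longrightarrow> M (T x) \<le> C * N x"
  shows "cont_linear s V N W M T" "op_norm V N M T \<le> C"
proof -
  interpret A: normed_vs s V N by fact
  show "cont_linear s V N W M T"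
    using assms bounded_linear_on_iff[OF assms(1-4)] unfolding cont_linear_def by blast
  show "op_norm V N M T \<le> C"
    using assms by (intro op_norm_le) auto
qed

section \<open>Finite-dimensional subspaces\<close>

text \<open>Completeness is a property of a set and a norm and not of a normed space, because it is proved
  for the subspaces of one normed space by induction on a basis.\<close>

definition complete_norm :: "'a::ab_group_add set \<Rightarrow> ('a \<Rightarrow> real) \<Rightarrow> bool"
  where "complete_norm S N \<longleftrightarrow> (\<forall>f :: nat \<Rightarrow> 'a.
    (\<forall>k. f k \<in> S) \<and> (\<forall>e>0. \<exists>m. \<forall>j\<ge>m. \<forall>k\<ge>m. N (f j - f k) < e) \<longrightarrow>
    (\<exists>l\<in>S. (\<lambda>k. N (f k - l)) \<longlonglongrightarrow> 0))"

text \<open>The limit \<open>b\<close> may lie outside the subspace from which the sequence is taken: this is how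
  Cauchy sequences arise, both for distances and for extensions.\<close>

lemma (in normed_vs) Cauchy_if_close:
  assumes "\<And>k. f k \<in> V" "b \<in> V" "(\<lambda>k. N (b - f k)) \<longlonglongrightarrow> 0" "e > 0"
  shows "\<exists>m. \<forall>j\<ge>m. \<forall>k\<ge>m. N (f j - f k) < e"
proof -
  obtain m where m: "\<And>k. k \<ge> m \<Longrightarrow> N (b - f k) < e / 2"
    using LIMSEQ_D[OF assms(3), of "e / 2"] \<open>e > 0\<close> assms(1,2) by auto
  have "N (f j - f k) < e" if "j \<ge> m" "k \<ge> m" for j k
    using nrm_triangle[of "f j" b "f k"] nrm_commute[of "f j" b] m[OF that(1)] m[OF that(2)]
      assms(1,2) by simp
  then show ?thesis by blast
qed

locale normed_vs_complete_field = normed_vs s V N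
  for s :: "'k::scalar_field \<Rightarrow> 'a::ab_group_add \<Rightarrow> 'a" and V N
begin

text \<open>If \<open>b\<close> had distance 0 from \<open>S\<close>, it would be the limit of a Cauchy sequence in \<open>S\<close> and
  hence lie in \<open>S\<close>. A positive distance \<open>d\<close> bounds the coefficient of \<open>b\<close> in any
  vector of the span of \<open>b\<close> and \<open>S\<close>.\<close>

lemma distance_to_complete_subspace:
  assumes S: "complete_norm S N" "subspace S" "S \<subseteq> V" and b: "b \<in> V" "b \<notin> S"
  obtains d where "d > 0" "\<And>a y. y \<in> S \<Longrightarrow> norm a * d \<le> N (s a b + y)"
proof -
  have "\<exists>d>0. \<forall>y\<in>S. d \<le> N (b - y)"
  proof (rule ccontr)
    assume "\<not> ?thesis"
    then have "\<forall>k. \<exists>y\<in>S. N (b - y) < 1 / real (Suc k)"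
      by (metis not_le of_nat_0_less_iff zero_less_Suc zero_less_divide_1_iff)
    then obtain y where y: "\<And>k. y k \<in> S" "\<And>k. N (b - y k) < 1 / real (Suc k)"
      by metis
    have yV: "y k \<in> V" for k
      using y(1) S(3) by blast
    have lim: "(\<lambda>k. N (b - y k)) \<longlonglongrightarrow> 0"
      by (rule tendsto_sandwich[OF _ _ tendsto_const LIMSEQ_Suc[OF lim_1_over_n]])
        (use b yV y(2) in \<open>auto intro!: always_eventually less_imp_le\<close>)
    then obtain l where l: "l \<in> S" "(\<lambda>k. N (y k - l)) \<longlonglongrightarrow> 0"
      using S(1) y(1) Cauchy_if_close[OF yV b(1) lim] unfolding complete_norm_def by blast
    have "(\<lambda>k. N (b - y k) + N (y k - l)) \<longlonglongrightarrow> 0"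
      using tendsto_add[OF lim l(2)] by simp
    moreover have "\<forall>k\<ge>0. N (b - l) \<le> N (b - y k) + N (y k - l)"
      using nrm_triangle[OF b(1) yV] l(1) S(3) by auto
    ultimately have "N (b - l) \<le> 0"
      by (meson LIMSEQ_le_const)
    moreover have "b - l \<in> V"
      using b l(1) S(3) by auto
    ultimately have "b = l"
      using nrm_eq_0[of "b - l"] nrm_nonneg[of "b - l"] by (metis antisym right_minus_eq)
    then show False
      using l(1) b by simp
  qed
  then obtain d where d: "d > 0" "\<And>y. y \<in> S \<Longrightarrow> d \<le> N (b - y)"
    by blast
  show ?thesis
  proof (rule that[OF d(1)])
    fix a y assume y: "y \<in> S"
    show "norm a * d \<le> N (s a b + y)"
    proof (cases "a = 0")
      case True
      then show ?thesis
        using y S(3) by auto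
    next
      case False
      have yS: "s (- (1 / a)) y \<in> S"
        using subspace_scale[OF S(2) y] .
      have "s a b + y = s a (b - s (- (1 / a)) y)"
        using False by (simp add: scale_right_distrib)
      moreover have "b - s (- (1 / a)) y \<in> V"
        using yS S(3) b by (meson mem(4) subsetD)
      ultimately show ?thesis
        using d(2)[OF yS] by (simp add: nrm_scale mult_left_mono)
    qed
  qed
qed

text \<open>A Cauchy sequence in the larger span splits into the multiples of \<open>b\<close>, whose coefficients are
  Cauchy by the previous lemma and converge because the scalar field is complete, and a remainder that is then
  Cauchy in the smaller span.\<close>

lemma complete_span_insert:
  assumes S: "complete_norm (span B) N" "B \<subseteq> V" and b: "b \<in> V"
  shows "complete_norm (span (insert b B)) N"
proof (cases "b \<in> span B")
  case True
  then show ?thesis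
    using S(1) by (simp add: span_redundant)
next
  case False
  have SV: "span B \<subseteq> V"
    using span_minimal[OF S(2) sub] .
  obtain d where d: "d > 0" "\<And>a y. y \<in> span B \<Longrightarrow> norm a * d \<le> N (s a b + y)"
    using distance_to_complete_subspace[OF S(1) subspace_span SV b False] by blast
  show ?thesis
    unfolding complete_norm_def
  proof (intro allI impI, elim conjE)
    fix f :: "nat \<Rightarrow> 'a"
    assume f: "\<forall>k. f k \<in> span (insert b B)"
      and cauchy: "\<forall>e>0. \<exists>m. \<forall>j\<ge>m. \<forall>k\<ge>m. N (f j - f k) < e"
    have "\<forall>k. \<exists>a. f k - s a b \<in> span B"
      using f by (simp add: span_breakdown_eq)
    then obtain a where a: "\<And>k. f k - s (a k) b \<in> span B"
      by metis
    define y where "y k = f k - s (a k) b" for k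
    have yS: "y k \<in> span B" for k
      using a by (simp add: y_def)
    then have yV: "y k \<in> V" for k
      using SV by blast
    have diff: "f j - f k = s (a j - a k) b + (y j - y k)" for j k
      by (simp add: y_def scale_left_diff_distrib)
    have fV: "f j - f k \<in> V" for j k
      using yV b by (simp add: diff)
    have da: "norm (a j - a k) * d \<le> N (f j - f k)" for j k
      unfolding diff by (intro d(2) span_diff yS)
    have "Cauchy a"
    proof (rule CauchyI)
      fix e :: real assume "e > 0"
      then obtain m where "\<forall>j\<ge>m. \<forall>k\<ge>m. N (f j - f k) < e * d"
        using cauchy d(1) by (meson mult_pos_pos)
      then have "\<forall>j\<ge>m. \<forall>k\<ge>m. norm (a j - a k) * d < e * d"
        using da by (meson le_less_trans)
      then show "\<exists>m. \<forall>j\<ge>m. \<forall>k\<ge>m. norm (a j - a k) < e"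
        using d(1) by auto
    qed
    then obtain a0 where a0: "a \<longlonglongrightarrow> a0"
      using Cauchy_convergent_iff convergent_def by blast
    have "\<exists>m. \<forall>j\<ge>m. \<forall>k\<ge>m. N (y j - y k) < e" if e: "e > 0" for e
    proof -
      define r where "r = e / (2 * (N b + 1))"
      have "N b \<ge> 0"
        using b by simp
      then have r: "r > 0" "r * N b \<le> e / 2"
        using e by (simp_all add: r_def field_simps)
      obtain m1 where m1: "\<And>j k. j \<ge> m1 \<Longrightarrow> k \<ge> m1 \<Longrightarrow> norm (a j - a k) < r"
        using CauchyD[OF \<open>Cauchy a\<close> r(1)] by blast
      obtain m2 where m2: "\<And>j k. j \<ge> m2 \<Longrightarrow> k \<ge> m2 \<Longrightarrow> N (f j - f k) < e / 2"
        using cauchy e by (meson half_gt_zero)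
      have "N (y j - y k) < e" if "j \<ge> max m1 m2" "k \<ge> max m1 m2" for j k
      proof -
        have "y j - y k = (f j - f k) + s (a k - a j) b"
          by (simp add: diff flip: scale_left_distrib)
        then have "N (y j - y k) \<le> N (f j - f k) + norm (a k - a j) * N b"
          using nrm_add[OF fV, of "s (a k - a j) b" j k] b by (simp add: nrm_scale)
        moreover have "norm (a k - a j) * N b \<le> r * N b"
          using m1[of k j] that \<open>N b \<ge> 0\<close> by (intro mult_right_mono) auto
        ultimately show ?thesis
          using m2[of j k] that r(2) by simp
      qed
      then show ?thesis by blast
    qed
    then obtain l where l: "l \<in> span B" "(\<lambda>k. N (y k - l)) \<longlonglongrightarrow> 0"
      using S(1) yS unfolding complete_norm_def by blast
    have lV: "l \<in> V"
      using l SV by blast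
    have bound: "N (f k - (s a0 b + l)) \<le> norm (a k - a0) * N b + N (y k - l)" for k
    proof -
      have *: "f k - (s a0 b + l) = s (a k - a0) b + (y k - l)"
        by (simp add: y_def scale_left_diff_distrib)
      show ?thesis
        unfolding * using nrm_add[of "s (a k - a0) b" "y k - l"] b yV lV by (simp add: nrm_scale)
    qed
    have fkV: "f k \<in> V" for k
      using yV[of k] b mem(3)[of "y k" "s (a k) b"] by (simp add: y_def)
    have "(\<lambda>k. norm (a k - a0) * N b + N (y k - l)) \<longlonglongrightarrow> 0 * N b + 0"
      using a0 l(2) by (intro tendsto_intros) (auto simp: LIM_zero_iff tendsto_norm_zero_iff)
    then have "(\<lambda>k. norm (a k - a0) * N b + N (y k - l)) \<longlonglongrightarrow> 0"
      by simp
    then have "(\<lambda>k. N (f k - (s a0 b + l))) \<longlonglongrightarrow> 0"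
      by (rule tendsto_sandwich[OF _ _ tendsto_const, rotated 2])
        (use bound fkV b lV in \<open>auto intro!: always_eventually\<close>)
    moreover have "s a0 b + l \<in> span (insert b B)"
      using l(1) by (simp add: span_breakdown_eq) (metis add_diff_cancel_left')
    ultimately show "\<exists>l\<in>span (insert b B). (\<lambda>k. N (f k - l)) \<longlonglongrightarrow> 0"
      by blast
  qed
qed

lemma complete_span_finite: "finite B \<Longrightarrow> B \<subseteq> V \<Longrightarrow> complete_norm (span B) N"
proof (induction B rule: finite_induct)
  case empty
  show ?case
    by (auto simp: complete_norm_def)
qed (simp add: complete_span_insert)

lemma complete_finite_dim:
  assumes "finite_dim s M" "M \<subseteq> V"
  shows "complete_norm M N"
proof -
  obtain B where B: "finite B" "span B = M"
    using assms(1) unfolding finite_dim_def by blast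
  then show ?thesis
    using complete_span_finite[of B] assms(2) span_superset[of B] by blast
qed

text \<open>The coordinate of \<open>b\<close> is controlled by the distance from \<open>b\<close> to the span of the other basis
  vectors, which is complete.\<close>

lemma bounded_coordinate:
  assumes B: "finite B" "independent B" "B \<subseteq> V" and b: "b \<in> B"
  obtains C where "C \<ge> 0" "\<And>x. x \<in> span B \<Longrightarrow> norm (representation B x b) \<le> C * N x"
proof -
  have "b \<notin> span (B - {b})"
    using B(2) b unfolding dependent_def by blast
  moreover have "complete_norm (span (B - {b})) N" "span (B - {b}) \<subseteq> V" "b \<in> V"
    using B b complete_span_finite[of "B - {b}"] span_minimal[OF _ sub, of "B - {b}"] by auto
  ultimately obtain d where d: "d > 0" "\<And>a y. y \<in> span (B - {b}) \<Longrightarrow> norm a * d \<le> N (s a b + y)"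
    using distance_to_complete_subspace[OF _ subspace_span] by metis
  show ?thesis
  proof (rule that[of "1 / d"])
    fix x assume x: "x \<in> span B"
    have "(\<Sum>v\<in>B - {b}. s (representation B x v) v) \<in> span (B - {b})"
      by (intro span_sum span_scale span_base)
    moreover have "x = s (representation B x b) b + (\<Sum>v\<in>B - {b}. s (representation B x v) v)"
      using sum_representation_eq[OF B(2) x B(1)] b B(1) by (simp add: sum.remove)
    ultimately show "norm (representation B x b) \<le> 1 / d * N x"
      using d by (metis divide_inverse mult.commute mult.left_neutral pos_le_divide_eq inverse_eq_divide)
  qed (use d(1) in simp)
qed

text \<open>Replace every vector of a basis of \<open>M\<close> by a nearby vector of \<open>D\<close>. Since the coordinates are
  bounded by multiples of the norm, the resulting error is a small multiple of the norm too.\<close>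

lemma push_into_dense_subspace:
  assumes D: "subspace D" "D \<subseteq> V" "norm_topology V N closure_of D = V"
    and M: "M \<in> FIN s V" and "e > 0"
  obtains R where "linear_on s s M R" "R \<in> M \<rightarrow> D" "\<And>x. x \<in> M \<Longrightarrow> N (R x - x) \<le> e * N x"
proof -
  have MV: "subspace M" "M \<subseteq> V" and "finite_dim s M"
    using M by (auto simp: FIN_def)
  then obtain G where G: "finite G" "span G = M"
    unfolding finite_dim_def by blast
  obtain B where B: "B \<subseteq> M" "independent B" "M \<subseteq> span B"
    using maximal_independent_subset by blast
  have fB: "finite B"
    using independent_span_bound[OF G(1) B(2)] B(1) G(2) by blast
  have spB: "span B = M"
    using B span_minimal[OF B(1) MV(1)] by blast
  have BV: "B \<subseteq> V"
    using B(1) MV(2) by blast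
  have "\<forall>b\<in>B. \<exists>C\<ge>0. \<forall>x\<in>M. norm (representation B x b) \<le> C * N x"
    using bounded_coordinate[OF fB B(2) BV] unfolding spB by metis
  then obtain C where C: "\<And>b. b \<in> B \<Longrightarrow> C b \<ge> 0"
    "\<And>b x. b \<in> B \<Longrightarrow> x \<in> M \<Longrightarrow> norm (representation B x b) \<le> C b * N x"
    by metis
  \<comment> \<open>With this distance for every basis vector the errors add up to at most \<open>e * N x\<close>.\<close>
  define r where "r = e / (sum C B + 1)"
  have sC: "sum C B \<ge> 0"
    using C(1) by (intro sum_nonneg) auto
  have r: "r > 0" "sum C B * r \<le> e"
    using \<open>e > 0\<close> sC by (simp_all add: r_def field_simps)
  have "\<forall>b\<in>B. \<exists>y\<in>D. N (b - y) < r"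
    using D(3) r(1) BV unfolding dense_iff by blast
  then obtain y where y: "\<And>b. b \<in> B \<Longrightarrow> y b \<in> D" "\<And>b. b \<in> B \<Longrightarrow> N (b - y b) < r"
    by metis
  have yV: "y b \<in> V" "b \<in> V" if "b \<in> B" for b
    using that y D(2) BV by auto
  define R where "R x = (\<Sum>b\<in>B. s (representation B x b) (y b))" for x
  show ?thesis
  proof (rule that)
    show "linear_on s s M R"
      unfolding linear_on_def R_def using B(2)
      by (simp add: spB representation_add representation_scale scale_left_distrib sum.distrib
          scale_sum_right)
    show "R \<in> M \<rightarrow> D"
      unfolding R_def using y(1) by (auto intro!: subspace_sum subspace_scale D(1))
    fix x assume x: "x \<in> M"
    have Nx: "N x \<ge> 0"
      using x MV(2) by auto
    have "R x - x = (\<Sum>b\<in>B. s (representation B x b) (y b - b))"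
      using sum_representation_eq[OF B(2) _ fB subset_refl, of x] x
      by (simp add: R_def spB scale_right_diff_distrib sum_subtractf)
    also have "N \<dots> \<le> (\<Sum>b\<in>B. N (s (representation B x b) (y b - b)))"
      using yV by (intro nrm_sum) auto
    also have "\<dots> \<le> (\<Sum>b\<in>B. C b * N x * r)"
    proof (rule sum_mono)
      fix b assume b: "b \<in> B"
      have "N (y b - b) \<le> r"
        using y(2)[OF b] nrm_commute[OF yV[OF b]] by simp
      then show "N (s (representation B x b) (y b - b)) \<le> C b * N x * r"
        using b x Nx C yV[OF b] by (simp add: nrm_scale mult_mono)
    qed
    also have "\<dots> = sum C B * r * N x"
      by (simp add: sum_distrib_right sum_distrib_left mult_ac)
    also have "\<dots> \<le> e * N x"
      using r(2) Nx by (rule mult_right_mono)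
    finally show "N (R x - x) \<le> e * N x" .
  qed
qed

end

section \<open>Extension of contractions from a dense subspace\<close>

text \<open>The extension maps \<open>x\<close> to the limit of \<open>T y\<close> as \<open>y\<close> tends to \<open>x\<close> in \<open>D\<close>, which exists since
  the contraction \<open>T\<close> preserves Cauchy sequences.\<close>

lemma extend_contraction:
  fixes s :: "'k::real_normed_field \<Rightarrow> 'a::ab_group_add \<Rightarrow> 'a"
  assumes "normed_vs s V N" "normed_vs s W M" "complete_norm W M"
    and D: "module.subspace s D" "D \<subseteq> V" "norm_topology V N closure_of D = V"
    and T: "linear_on s s D T" "T \<in> D \<rightarrow> W" "\<And>x. x \<in> D \<Longrightarrow> M (T x) \<le> N x"
  obtains T' where "linear_on s s V T'" "T' \<in> V \<rightarrow> W" "\<And>x. x \<in> V \<Longrightarrow> M (T' x) \<le> N x"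
    "\<And>x. x \<in> D \<Longrightarrow> T' x = T x"
proof -
  interpret A: normed_vs s V N by fact
  interpret B: normed_vs s W M by fact
  interpret D: normed_vs s D N
    by unfold_locales (rule A.normed_subspace[OF D(1,2)])
  have DV: "x \<in> V" if "x \<in> D" for x
    using D(2) that by blast
  have TW: "T x \<in> W" if "x \<in> D" for x
    using T(2) that by blast
  have Tdiff: "M (T x - T y) \<le> N (x - y)" if "x \<in> D" "y \<in> D" for x y
    using T(3)[of "x - y"] that
      linear_on_diff[OF A.vector_space_axioms A.vector_space_axioms T(1) that]
    by simp
  \<comment> \<open>The closure of the graph of \<open>T\<close>. It is the graph of the extension, and its linearity is checked without choosing sequences.\<close>
  define near where "near x c \<longleftrightarrow> c \<in> W \<and> (\<forall>e>0. \<exists>y\<in>D. N (x - y) < e \<and> M (c - T y) < e)" for x c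
  have near_D: "near x (T x)" if "x \<in> D" for x
    using that TW[OF that] unfolding near_def by (intro conjI allI impI bexI[of _ x]) auto
  have near_ex: "\<exists>c. near x c" if x: "x \<in> V" for x
  proof -
    have "\<forall>k. \<exists>y\<in>D. N (x - y) < 1 / real (Suc k)"
      using D(3) x unfolding A.dense_iff by (meson IntD1 of_nat_0_less_iff zero_less_Suc zero_less_divide_1_iff)
    then obtain y where y: "\<And>k. y k \<in> D" "\<And>k. N (x - y k) < 1 / real (Suc k)"
      by metis
    have lim: "(\<lambda>k. N (x - y k)) \<longlonglongrightarrow> 0"
      by (rule tendsto_sandwich[OF _ _ tendsto_const LIMSEQ_Suc[OF lim_1_over_n]])
        (use x DV y in \<open>auto intro!: always_eventually less_imp_le\<close>)
    have "\<exists>m. \<forall>j\<ge>m. \<forall>k\<ge>m. M (T (y j) - T (y k)) < e" if "e > 0" for e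
      using A.Cauchy_if_close[OF DV[OF y(1)] x lim that] Tdiff[OF y(1) y(1)] by (meson le_less_trans)
    moreover have "\<forall>k. T (y k) \<in> W"
      using TW y(1) by blast
    ultimately obtain c where c: "c \<in> W" "(\<lambda>k. M (T (y k) - c)) \<longlonglongrightarrow> 0"
      using assms(3)[unfolded complete_norm_def, rule_format, of "\<lambda>k. T (y k)"] by blast
    have "\<exists>z\<in>D. N (x - z) < e \<and> M (c - T z) < e" if "e > 0" for e
    proof -
      have "eventually (\<lambda>k. N (x - y k) < e \<and> M (T (y k) - c) < e) sequentially"
        using order_tendstoD(2)[OF lim that] order_tendstoD(2)[OF c(2) that] by eventually_elim simp
      then obtain k where "N (x - y k) < e" "M (T (y k) - c) < e"
        by (auto dest: eventually_happens)
      then show ?thesis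
        using y(1)[of k] B.nrm_commute[OF c(1) TW[OF y(1)[of k]]] by auto
    qed
    then show ?thesis
      using c(1) unfolding near_def by blast
  qed
  have near_unique: "c = c'" if x: "x \<in> V" and c: "near x c" "near x c'" for x c c'
  proof -
    have W: "c \<in> W" "c' \<in> W"
      using c by (auto simp: near_def)
    have "M (c - c') \<le> 0 + e" if "e > 0" for e
    proof -
      have "e / 4 > 0"
        using that by simp
      obtain y where y: "y \<in> D" "N (x - y) < e / 4" "M (c - T y) < e / 4"
        using c(1) \<open>e / 4 > 0\<close> unfolding near_def by blast
      obtain z where z: "z \<in> D" "N (x - z) < e / 4" "M (c' - T z) < e / 4"
        using c(2) \<open>e / 4 > 0\<close> unfolding near_def by blast
      have "M (c - c') \<le> M (c - T y) + (M (T y - T z) + M (T z - c'))"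
        using B.nrm_triangle[OF W(1) TW[OF y(1)] W(2)]
          B.nrm_triangle[OF TW[OF y(1)] TW[OF z(1)] W(2)] by linarith
      moreover have "M (T y - T z) \<le> N (x - y) + N (x - z)"
        using Tdiff[OF y(1) z(1)] A.nrm_triangle[OF DV[OF y(1)] x DV[OF z(1)]]
          A.nrm_commute[OF x DV[OF y(1)]] by linarith
      moreover have "M (T z - c') = M (c' - T z)"
        using B.nrm_commute[OF W(2) TW[OF z(1)]] by simp
      ultimately show ?thesis
        using y z by linarith
    qed
    then have "M (c - c') \<le> 0"
      by (rule field_le_epsilon)
    then show ?thesis
      using B.nrm_eq_0[of "c - c'"] B.nrm_nonneg[of "c - c'"] W by (metis B.mem(4) antisym right_minus_eq)
  qed
  define T' where "T' x = (SOME c. near x c)" for x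
  have near_T': "near x (T' x)" if "x \<in> V" for x
    unfolding T'_def using near_ex[OF that] by (rule someI_ex)
  have T'_eq: "T' x = c" if "x \<in> V" "near x c" for x c
    using near_unique[OF that(1) near_T'[OF that(1)] that(2)] .
  have T'W: "T' x \<in> W" if "x \<in> V" for x
    using near_T'[OF that] by (simp add: near_def)
  have near_add: "near (x + x') (c + c')" if x: "x \<in> V" "x' \<in> V" and c: "near x c" "near x' c'" for x x' c c'
    unfolding near_def
  proof (intro conjI allI impI)
    have W: "c \<in> W" "c' \<in> W"
      using c by (auto simp: near_def)
    then show "c + c' \<in> W" by simp
    fix e :: real assume "e > 0"
    then have "e / 2 > 0" by simp
    obtain y where y: "y \<in> D" "N (x - y) < e / 2" "M (c - T y) < e / 2"
      using c(1) \<open>e / 2 > 0\<close> unfolding near_def by blast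
    obtain z where z: "z \<in> D" "N (x' - z) < e / 2" "M (c' - T z) < e / 2"
      using c(2) \<open>e / 2 > 0\<close> unfolding near_def by blast
    show "\<exists>w\<in>D. N (x + x' - w) < e \<and> M (c + c' - T w) < e"
    proof (intro bexI conjI)
      show "y + z \<in> D"
        using y z by simp
      have *: "x + x' - (y + z) = (x - y) + (x' - z)"
        by simp
      show "N (x + x' - (y + z)) < e"
        unfolding * using A.nrm_add[of "x - y" "x' - z"] x DV[OF y(1)] DV[OF z(1)] y z by simp
      have "T (y + z) = T y + T z"
        using T(1) y z by (simp add: linear_on_def)
      then have *: "c + c' - T (y + z) = (c - T y) + (c' - T z)"
        by simp
      show "M (c + c' - T (y + z)) < e"
        unfolding * using B.nrm_add[of "c - T y" "c' - T z"] W TW[OF y(1)] TW[OF z(1)] y z by simp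
    qed
  qed
  have near_scale: "near (s a x) (s a c)" if x: "x \<in> V" and c: "near x c" for a x c
    unfolding near_def
  proof (intro conjI allI impI)
    have W: "c \<in> W"
      using c by (auto simp: near_def)
    then show "s a c \<in> W" by simp
    fix e :: real assume "e > 0"
    define r where "r = e / (norm a + 1)"
    have np: "norm a + 1 > 0"
      by (simp add: add_nonneg_pos)
    have r: "r > 0"
      using \<open>e > 0\<close> np by (simp add: r_def)
    have small: "norm a * t < e" if "t < r" "0 \<le> t" for t
    proof -
      have "norm a * t \<le> (norm a + 1) * t"
        using that by (simp add: distrib_right)
      also have "\<dots> < e"
        using that np by (simp add: r_def field_simps)
      finally show ?thesis .
    qed
    obtain y where y: "y \<in> D" "N (x - y) < r" "M (c - T y) < r"
      using c r unfolding near_def by blast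
    show "\<exists>w\<in>D. N (s a x - w) < e \<and> M (s a c - T w) < e"
    proof (intro bexI conjI)
      show "s a y \<in> D"
        using y by simp
      show "N (s a x - s a y) < e"
        using small[OF y(2)] x DV[OF y(1)]
        by (simp add: A.nrm_scale flip: A.scale_right_diff_distrib)
      have "T (s a y) = s a (T y)"
        using T(1) y by (simp add: linear_on_def)
      then show "M (s a c - T (s a y)) < e"
        using small[OF y(3)] W TW[OF y(1)]
        by (simp add: B.nrm_scale flip: A.scale_right_diff_distrib)
    qed
  qed
  show ?thesis
  proof (rule that)
    show "linear_on s s V T'"
      unfolding linear_on_def
    proof (intro conjI ballI allI)
      show "T' (x + y) = T' x + T' y" if "x \<in> V" "y \<in> V" for x y
        using that by (intro T'_eq near_add near_T') auto
      show "T' (s a x) = s a (T' x)" if "x \<in> V" for a x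
        using that by (intro T'_eq near_scale near_T') auto
    qed
    show "T' \<in> V \<rightarrow> W"
      using T'W by blast
    show "T' x = T x" if "x \<in> D" for x
      using that by (intro T'_eq near_D DV)
    fix x assume x: "x \<in> V"
    have "M (T' x) \<le> N x + e" if "e > 0" for e
    proof -
      have "e / 2 > 0"
        using that by simp
      obtain y where y: "y \<in> D" "N (x - y) < e / 2" "M (T' x - T y) < e / 2"
        using near_T'[OF x] \<open>e / 2 > 0\<close> unfolding near_def by blast
      show ?thesis
        using B.nrm_le_diff[OF T'W[OF x] TW[OF y(1)]] A.nrm_le_diff[OF DV[OF y(1)] x]
          A.nrm_commute[OF x DV[OF y(1)]] T(3)[OF y(1)] y by linarith
    qed
    then show "M (T' x) \<le> N x"
      by (rule field_le_epsilon)
  qed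
qed

section \<open>Quotients\<close>

lemma (in vector_space) projection_exists:
  assumes "subspace L"
  obtains P where "Vector_Spaces.linear scale scale P" "range P \<subseteq> L" "\<And>x. x \<in> L \<Longrightarrow> P x = x"
proof -
  interpret vector_space_pair scale scale ..
  obtain B where B: "B \<subseteq> L" "independent B" "L \<subseteq> span B"
    using maximal_independent_subset by blast
  have spB: "span B = L"
    using B span_minimal[OF B(1) assms] by blast
  obtain P where P: "Vector_Spaces.linear scale scale P" "\<forall>x\<in>B. P x = id x" "range P = span (id ` B)"
    using linear_independent_extend_subspace[OF B(2)] by blast
  show ?thesis
  proof (rule that[OF P(1)])
    show "range P \<subseteq> L"
      using P(3) spB by simp
    show "P x = x" if "x \<in> L" for x
      using linear_eq_on[OF P(1) linear_id, of x B] P(2) that spB by simp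
  qed
qed

context normed_vs
begin

text \<open>The choice in the definition of \<^const>\<open>quot_space\<close> is possible: the kernel in \<open>V\<close> of a linear
  projection onto \<open>L\<close> is a complement of \<open>L\<close> in \<open>V\<close>.\<close>

lemma quot_space:
  assumes "subspace L" "L \<subseteq> V"
  shows "subspace (quot_space s V L)" "quot_space s V L \<subseteq> V" "quot_space s V L \<inter> L = {0}"
    "x \<in> V \<Longrightarrow> \<exists>c\<in>quot_space s V L. x - c \<in> L"
proof -
  obtain P where P: "Vector_Spaces.linear s s P" "range P \<subseteq> L" "\<And>x. x \<in> L \<Longrightarrow> P x = x"
    using projection_exists[OF assms(1)] by blast
  interpret P: Vector_Spaces.linear s s P by (rule P)
  have PL: "P x \<in> L" for x
    using P(2) by blast
  have "\<exists>C. subspace C \<and> C \<subseteq> V \<and> C \<inter> L = {0} \<and> (\<forall>x\<in>V. \<exists>c\<in>C. x - c \<in> L)"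
  proof (intro exI conjI ballI)
    show "subspace {x\<in>V. P x = 0}"
      by (rule subspaceI) (auto simp: P.add P.scale)
    show "{x\<in>V. P x = 0} \<inter> L = {0}"
      using P(3) subspace_0[OF assms(1)] by auto
    show "\<exists>c\<in>{x \<in> V. P x = 0}. x - c \<in> L" if "x \<in> V" for x
      by (rule bexI[of _ "x - P x"])
        (use that PL[of x] subsetD[OF assms(2) PL[of x]] P(3)[OF PL] in \<open>auto simp: P.diff\<close>)
  qed auto
  then have *: "subspace (quot_space s V L) \<and> quot_space s V L \<subseteq> V \<and> quot_space s V L \<inter> L = {0} \<and>
      (\<forall>x\<in>V. \<exists>c\<in>quot_space s V L. x - c \<in> L)"
    unfolding quot_space_def by (rule someI_ex)
  show "subspace (quot_space s V L)" "quot_space s V L \<subseteq> V" "quot_space s V L \<inter> L = {0}"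
    "x \<in> V \<Longrightarrow> \<exists>c\<in>quot_space s V L. x - c \<in> L"
    using * by auto
qed

lemma quot_map_eqI:
  assumes L: "subspace L" "L \<subseteq> V" and c: "c \<in> quot_space s V L" "x - c \<in> L"
  shows "quot_map s V L x = c"
  unfolding quot_map_def
proof (rule the_equality)
  show "c \<in> quot_space s V L \<and> x - c \<in> L"
    using c by simp
  fix c' assume c': "c' \<in> quot_space s V L \<and> x - c' \<in> L"
  then have "(x - c) - (x - c') \<in> L" "c' - c \<in> quot_space s V L"
    using c by (blast intro: subspace_diff[OF L(1)] subspace_diff[OF quot_space(1)[OF L]])+
  then have "c' - c \<in> quot_space s V L \<inter> L"
    by simp
  then show "c' = c"
    using quot_space(3)[OF L] by simp
qed

lemma quot_map:
  assumes L: "subspace L" "L \<subseteq> V" and x: "x \<in> V"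
  shows "quot_map s V L x \<in> quot_space s V L" "x - quot_map s V L x \<in> L"
proof -
  obtain c where c: "c \<in> quot_space s V L" "x - c \<in> L"
    using quot_space(4)[OF L x] by blast
  then show "quot_map s V L x \<in> quot_space s V L" "x - quot_map s V L x \<in> L"
    using quot_map_eqI[OF L c] by auto
qed

lemma linear_on_quot_map:
  assumes L: "subspace L" "L \<subseteq> V"
  shows "linear_on s s V (quot_map s V L)"
  unfolding linear_on_def
proof (intro conjI ballI allI)
  note Q = quot_map[OF L]
  show "quot_map s V L (x + y) = quot_map s V L x + quot_map s V L y" if x: "x \<in> V" "y \<in> V" for x y
  proof (rule quot_map_eqI[OF L])
    show "quot_map s V L x + quot_map s V L y \<in> quot_space s V L"
      using Q x by (intro subspace_add[OF quot_space(1)[OF L]])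
    show "x + y - (quot_map s V L x + quot_map s V L y) \<in> L"
      using subspace_add[OF L(1) Q(2)[OF x(1)] Q(2)[OF x(2)]] by (simp add: algebra_simps)
  qed
  show "quot_map s V L (s a x) = s a (quot_map s V L x)" if x: "x \<in> V" for a x
  proof (rule quot_map_eqI[OF L])
    show "s a (quot_map s V L x) \<in> quot_space s V L"
      using Q x by (intro subspace_scale[OF quot_space(1)[OF L]])
    show "s a x - s a (quot_map s V L x) \<in> L"
      using subspace_scale[OF L(1) Q(2)[OF x], of a] by (simp add: scale_right_diff_distrib)
  qed
qed

lemma quot_norm_le:
  assumes L: "L \<subseteq> V" and x: "x \<in> V" "l \<in> L"
  shows "quot_norm N L x \<le> N (x + l)"
  unfolding quot_norm_def
proof (rule cInf_lower)
  show "bdd_below {N (x + l) |l. l \<in> L}"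
    by (rule bdd_belowI[of _ 0]) (use L x in auto)
qed (use x in blast)

lemma quot_norm_greatest:
  assumes L: "subspace L" and r: "\<And>l. l \<in> L \<Longrightarrow> r \<le> N (x + l)"
  shows "r \<le> quot_norm N L x"
  unfolding quot_norm_def using subspace_0[OF L] r by (intro cInf_greatest) auto

lemma quot_norm_quot_map:
  assumes L: "subspace L" "L \<subseteq> V" and x: "x \<in> V"
  shows "quot_norm N L (quot_map s V L x) \<le> N x"
  using quot_norm_le[OF L(2) _ quot_map(2)[OF L x], of "quot_map s V L x"]
    quot_map(1)[OF L x] quot_space(2)[OF L] by auto

text \<open>Closedness of \<open>L\<close> makes the quotient seminorm definite: a vector outside \<open>L\<close> has a positive
  distance from \<open>L\<close>.\<close>

lemma normed_quot_space:
  assumes L: "L \<in> COFIN s V N"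
  shows "normed_space s (quot_space s V L) (quot_norm N L)"
proof -
  have sL: "subspace L" "L \<subseteq> V" and cL: "closedin (norm_topology V N) L"
    using L by (auto simp: COFIN_def)
  note C = quot_space[OF sL]
  have CV: "x \<in> V" if "x \<in> quot_space s V L" for x
    using C(2) that by blast
  have LV: "x \<in> V" if "x \<in> L" for x
    using sL(2) that by blast
  have nonneg: "0 \<le> quot_norm N L x" if "x \<in> V" for x
    using that by (intro quot_norm_greatest[OF sL(1)]) (simp add: LV)
  have q0: "quot_norm N L 0 = 0"
    using nonneg[of 0] quot_norm_le[OF sL(2), of 0 0] subspace_0[OF sL(1)] by simp
  have scale_le: "quot_norm N L (s a x) \<le> norm a * quot_norm N L x" if x: "x \<in> V" and a: "a \<noteq> 0" for a x
  proof -
    have "quot_norm N L (s a x) / norm a \<le> quot_norm N L x"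
    proof (rule quot_norm_greatest[OF sL(1)])
      fix l assume l: "l \<in> L"
      have "quot_norm N L (s a x) \<le> N (s a x + s a l)"
        using quot_norm_le[OF sL(2), of "s a x" "s a l"] x subspace_scale[OF sL(1) l] by simp
      also have "\<dots> = norm a * N (x + l)"
        using x LV[OF l] by (simp add: nrm_scale flip: scale_right_distrib)
      finally show "quot_norm N L (s a x) / norm a \<le> N (x + l)"
        using a by (simp add: field_simps)
    qed
    then show ?thesis
      using a by (simp add: field_simps)
  qed
  show ?thesis
    unfolding normed_space_def
  proof (intro conjI ballI allI)
    show "subspace (quot_space s V L)"
      by (rule C)
    fix x assume x: "x \<in> quot_space s V L"
    show "0 \<le> quot_norm N L x"
      using nonneg CV x by blast
    show "quot_norm N L x = 0 \<longleftrightarrow> x = 0"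
    proof
      assume 0: "quot_norm N L x = 0"
      show "x = 0"
      proof (rule ccontr)
        assume "x \<noteq> 0"
        then have "x \<notin> L"
          using C(3) x by blast
        then obtain r where r: "r > 0" "\<And>y. y \<in> L \<Longrightarrow> N (x - y) \<ge> r"
          using closed_imp_distance[OF cL CV[OF x]] by blast
        have "r \<le> quot_norm N L x"
          using r(2)[OF subspace_neg[OF sL(1)]] by (intro quot_norm_greatest[OF sL(1)]) simp
        then show False
          using 0 r(1) by simp
      qed
    qed (simp add: q0)
    show "quot_norm N L (s a x) = norm a * quot_norm N L x" for a
    proof (cases "a = 0")
      case False
      have "quot_norm N L x \<le> quot_norm N L (s a x) / norm a"
        using scale_le[of "s a x" "1 / a"] False CV[OF x] by (simp add: norm_divide)
      then have "norm a * quot_norm N L x \<le> quot_norm N L (s a x)"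
        using False by (simp add: field_simps)
      then show ?thesis
        using scale_le[OF CV[OF x] False] by simp
    qed (simp add: q0)
    fix y assume y: "y \<in> quot_space s V L"
    have "quot_norm N L (x + y) - quot_norm N L x \<le> quot_norm N L y"
    proof (rule quot_norm_greatest[OF sL(1)])
      fix l assume l: "l \<in> L"
      have "quot_norm N L (x + y) - N (y + l) \<le> quot_norm N L x"
      proof (rule quot_norm_greatest[OF sL(1)])
        fix m assume m: "m \<in> L"
        have "quot_norm N L (x + y) \<le> N (x + y + (m + l))"
          using quot_norm_le[OF sL(2), of "x + y" "m + l"] CV x y subspace_add[OF sL(1) m l] by simp
        also have "\<dots> = N ((x + m) + (y + l))"
          by (simp add: algebra_simps)
        also have "\<dots> \<le> N (x + m) + N (y + l)"
          using CV LV x y l m by (intro nrm_add) auto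
        finally show "quot_norm N L (x + y) - N (y + l) \<le> N (x + m)"
          by simp
      qed
      then show "quot_norm N L (x + y) - quot_norm N L x \<le> N (y + l)"
        by simp
    qed
    then show "quot_norm N L (x + y) \<le> quot_norm N L x + quot_norm N L y"
      by simp
  qed
qed

text \<open>The trivial quotient shows that the supremum in the definition of cofinite generation is taken
  over a nonempty set.\<close>

lemma whole_space_in_COFIN: "V \<in> COFIN s V N"
proof -
  have "quot_space s V V = {0}"
    using quot_space(2,3)[OF sub subset_refl] by blast
  moreover have "finite_dim s {0}"
    unfolding finite_dim_def by (intro exI[of _ "{}"]) simp
  moreover have "closedin (norm_topology V N) V"
    using closedin_topspace[of "norm_topology V N"] by simp
  ultimately show ?thesis
    using sub by (simp add: COFIN_def)
qed

end

section \<open>Symmetric tensors\<close>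

lemma vector_space_tscale: "vector_space (tscale :: 'k::real_normed_field \<Rightarrow> ('v, 'k) tensor \<Rightarrow> ('v, 'k) tensor)"
  by unfold_locales (auto simp: tscale_def plus_fun_def fun_eq_iff algebra_simps)

interpretation tensor: vector_space "tscale :: 'k::real_normed_field \<Rightarrow> ('v, 'k) tensor \<Rightarrow> ('v, 'k) tensor"
  by (rule vector_space_tscale)

lemma sum_fun_apply: "(\<Sum>i\<in>I. f i) x = (\<Sum>i\<in>I. f i x)"
  by (induction I rule: infinite_finite_induct) simp_all

lemma tscale_apply: "tscale c z A = c * z A"
  by (simp add: tscale_def)

lemma is_rep_in_sym_tensors: "is_rep s n V z r c x \<Longrightarrow> z \<in> sym_tensors s n V"
  unfolding is_rep_def sym_tensors_def
  by (elim conjE, simp only:) (intro tensor.span_sum tensor.span_scale tensor.span_base imageI, simp)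

lemma tpow_in_sym_tensors: "x \<in> V \<Longrightarrow> tpow s n x \<in> sym_tensors s n V"
  unfolding sym_tensors_def by (intro tensor.span_base imageI)

lemma is_rep_exists:
  assumes "z \<in> sym_tensors s n V"
  obtains r c x where "is_rep s n V z r c x"
proof -
  have "\<exists>r c x. is_rep s n V z r c x"
    using assms unfolding sym_tensors_def
  proof (induction rule: tensor.span_induct_alt)
    case base
    show ?case
      by (intro exI[of _ "0 :: nat"]) (simp add: is_rep_def zero_fun_def)
  next
    case (step a y w)
    then obtain v where v: "v \<in> V" "y = tpow s n v"
      by blast
    obtain r c x where "is_rep s n V w r c x"
      using step.IH by blast
    then have "is_rep s n V (tscale a y + w) (Suc r) (c(r := a)) (x(r := v))"
      using v by (auto simp: is_rep_def less_Suc_eq)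
    then show ?case by blast
  qed
  then show ?thesis
    using that by blast
qed

lemma is_rep_mono: "is_rep s n V z r c x \<Longrightarrow> V \<subseteq> W \<Longrightarrow> is_rep s n W z r c x"
  by (auto simp: is_rep_def)

lemma sym_tensors_mono: "V \<subseteq> W \<Longrightarrow> sym_tensors s n V \<subseteq> sym_tensors s n W"
  unfolding sym_tensors_def by (intro tensor.span_mono image_mono)

lemma multilinear_on_comp:
  assumes A: "multilinear_on s n W A" and T: "linear_on s s V T" "T \<in> V \<rightarrow> W"
  shows "multilinear_on s n V (\<lambda>x. A (\<lambda>i\<in>{..<n}. T (x i)))"
  unfolding multilinear_on_def
proof (intro ballI allI impI)
  fix x i assume x: "x \<in> {..<n} \<rightarrow>\<^sub>E V" and i: "i < n"
  define y where "y = (\<lambda>i\<in>{..<n}. T (x i))"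
  have "y \<in> {..<n} \<rightarrow>\<^sub>E W"
    using x T(2) by (auto simp: y_def PiE_iff Pi_iff)
  then have lin: "linear_on s (*) W (\<lambda>v. A (y(i := v)))"
    using A i unfolding multilinear_on_def by blast
  have upd: "(\<lambda>j\<in>{..<n}. T ((x(i := v)) j)) = y(i := T v)" for v
    using i by (auto simp: y_def)
  show "linear_on s (*) V (\<lambda>v. A (\<lambda>j\<in>{..<n}. T ((x(i := v)) j)))"
    unfolding upd using lin T by (auto simp: linear_on_def Pi_iff)
qed

lemma rep_eval:
  assumes "is_rep s n V z r c x" "multilinear_on s n UNIV A"
  shows "z A = (\<Sum>j<r. c j * A (diag n (x j)))"
  using assms by (simp add: is_rep_def sum_fun_apply tscale_apply tpow_def elem_tensor_def)

text \<open>The value of \<^const>\<open>sym_lin\<close> can be read off any representation once all representations give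
  the same value.\<close>

lemma sym_lin_rep:
  assumes "is_rep s n V z r c x"
    and "\<And>r' c' x'. is_rep s n V z r' c' x' \<Longrightarrow> (\<Sum>j<r'. sc (c' j) (f (x' j))) = w"
  shows "sym_lin s sc n V f z = w"
  unfolding sym_lin_def
proof (rule the_equality)
  show "\<exists>r c x. is_rep s n V z r c x \<and> w = (\<Sum>j<r. sc (c j) (f (x j)))"
    using assms by metis
qed (use assms(2) in auto)

lemma restrict_comp_diag: "(\<lambda>i\<in>{..<n}. T (diag n x i)) = diag n (T x)"
  by (auto simp: diag_def)

text \<open>Composition with a projection onto \<open>V\<close>. Tensors are tested only against forms on the whole
  ambient space, so maps and forms given on \<open>V\<close> have to be extended before they can act on tensors.\<close>

lemma linear_on_extend:
  assumes "vector_space s" "module.subspace s V" "linear_on s s V T"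
  obtains T' where "linear_on s s UNIV T'" "\<And>x. x \<in> V \<Longrightarrow> T' x = T x" "range T' \<subseteq> T ` V"
proof -
  interpret vector_space s by fact
  obtain P where P: "Vector_Spaces.linear s s P" "range P \<subseteq> V" "\<And>x. x \<in> V \<Longrightarrow> P x = x"
    using projection_exists[OF assms(2)] by blast
  interpret P: Vector_Spaces.linear s s P by (rule P)
  have PV: "P x \<in> V" for x
    using P(2) by blast
  show ?thesis
  proof (rule that[of "T \<circ> P"])
    show "linear_on s s UNIV (T \<circ> P)"
      using assms(3) PV by (auto simp: linear_on_def P.add P.scale)
  qed (use P(3) PV in auto)
qed

text \<open>The functional of a polynomial is evaluation of tensors at one single form \<open>A'\<close>, an extension of
  \<open>A\<close> to the ambient space. Evaluation depends on the tensor only, so all representations give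
  the same value, and it is linear.\<close>

lemma form_functional:
  fixes s :: "'k::real_normed_field \<Rightarrow> 'v::ab_group_add \<Rightarrow> 'v"
  assumes "vector_space s" "module.subspace s V" "multilinear_on s n V A"
    and f: "\<And>x. x \<in> V \<Longrightarrow> f x = A (diag n x)"
  obtains A' where "\<And>z. z \<in> sym_tensors s n V \<Longrightarrow> poly_functional s n V f z = z A'"
    "\<And>z r c x. is_rep s n V z r c x \<Longrightarrow> z A' = (\<Sum>j<r. c j * f (x j))"
proof -
  have "linear_on s s V (\<lambda>x. x)"
    by (simp add: linear_on_def)
  then obtain P where P: "linear_on s s UNIV P" "\<And>x. x \<in> V \<Longrightarrow> P x = x" "range P \<subseteq> (\<lambda>x. x) ` V"
    using linear_on_extend[OF assms(1,2)] by metis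
  define A' where "A' = (\<lambda>x. A (\<lambda>i\<in>{..<n}. P (x i)))"
  have A': "multilinear_on s n UNIV A'"
    unfolding A'_def using P(3) by (intro multilinear_on_comp[OF assms(3) P(1)]) auto
  have ev: "z A' = (\<Sum>j<r. c j * f (x j))" if rep: "is_rep s n V z r c x" for z r c x
  proof -
    have "A' (diag n (x j)) = f (x j)" if "j < r" for j
    proof -
      have "x j \<in> V"
        using that rep by (simp add: is_rep_def)
      then show ?thesis
        unfolding A'_def restrict_comp_diag[where T = P and x = "x j"] by (simp only: P(2) f)
    qed
    then show ?thesis
      using rep_eval[OF rep A'] by simp
  qed
  show ?thesis
  proof (rule that)
    show "z A' = (\<Sum>j<r. c j * f (x j))" if "is_rep s n V z r c x" for z r c x
      using that by (rule ev)
    fix z assume "z \<in> sym_tensors s n V"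
    then obtain r c x where "is_rep s n V z r c x"
      using is_rep_exists by blast
    then show "poly_functional s n V f z = z A'"
      unfolding poly_functional_def
      by (rule sym_lin_rep[where f = f and sc = "(*)" and w = "z A'"]) (metis ev)
  qed
qed

text \<open>The right-hand side does not depend on the representation, because at a form \<open>A\<close> it is the value of \<open>z\<close>
  at the form obtained by composing \<open>A\<close> with an extension of \<open>T\<close>.\<close>

lemma sym_map_rep:
  fixes s :: "'k::real_normed_field \<Rightarrow> 'v::ab_group_add \<Rightarrow> 'v"
  assumes "vector_space s" "module.subspace s V" "linear_on s s V T"
    and rep: "is_rep s n V z r c x"
  shows "sym_map s n V T z = (\<Sum>j<r. tscale (c j) (tpow s n (T (x j))))"
proof -
  obtain T' where T': "linear_on s s UNIV T'" "\<And>x. x \<in> V \<Longrightarrow> T' x = T x"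
    using linear_on_extend[OF assms(1-3)] by metis
  \<comment> \<open>The tensor power of the extension of \<open>T\<close>, written as a transpose.\<close>
  define w where "w = (\<lambda>A. if multilinear_on s n UNIV A then z (\<lambda>x. A (\<lambda>i\<in>{..<n}. T' (x i))) else 0)"
  have w: "(\<Sum>j<r. tscale (c j) (tpow s n (T (x j)))) = w" if rep: "is_rep s n V z r c x" for r c x
  proof
    fix A :: "(nat \<Rightarrow> 'v) \<Rightarrow> 'k"
    show "(\<Sum>j<r. tscale (c j) (tpow s n (T (x j)))) A = w A"
    proof (cases "multilinear_on s n UNIV A")
      case True
      define A' where "A' = (\<lambda>x. A (\<lambda>i\<in>{..<n}. T' (x i)))"
      have A': "multilinear_on s n UNIV A'"
        unfolding A'_def by (rule multilinear_on_comp[OF True T'(1)]) simp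
      have "A' (diag n (x j)) = A (diag n (T (x j)))" if "j < r" for j
      proof -
        have "x j \<in> V"
          using that rep by (simp add: is_rep_def)
        then show ?thesis
          unfolding A'_def restrict_comp_diag[where T = T' and x = "x j"] by (simp only: T'(2))
      qed
      moreover have "z A' = (\<Sum>j<r. c j * A' (diag n (x j)))"
        using rep A' by (rule rep_eval)
      ultimately have "z A' = (\<Sum>j<r. c j * A (diag n (T (x j))))"
        by simp
      then show ?thesis
        using True by (simp add: w_def A'_def sum_fun_apply tscale_apply tpow_def elem_tensor_def)
    qed (simp add: w_def sum_fun_apply tscale_apply tpow_def elem_tensor_def)
  qed
  show ?thesis
    unfolding sym_map_def w[OF rep]
    by (rule sym_lin_rep[where f = "\<lambda>x. tpow s n (T x)" and sc = tscale and w = w, OF rep]) (rule w)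
qed

section \<open>Interpolating powers along a line\<close>

text \<open>Expand one argument after the other: replacing \<open>f m\<close> by \<open>x + s t u\<close> writes the form as a
  value at \<open>x\<close> plus \<open>t\<close> times a value at \<open>u\<close>, and so raises the degree in \<open>t\<close> by at most one.\<close>

lemma multilinear_on_line:
  assumes A: "multilinear_on s n UNIV A"
  obtains P where "degree P \<le> n" "\<And>t. A (diag n (x + s t u)) = poly P t"
proof -
  have ex: "\<forall>f\<in>{..<n} \<rightarrow>\<^sub>E UNIV. \<exists>P. degree P \<le> m \<and>
      (\<forall>t. A (\<lambda>i\<in>{..<n}. if i < m then x + s t u else f i) = poly P t)" if "m \<le> n" for m
    using that
  proof (induction m)
    case 0
    show ?case
    proof
      fix f :: "nat \<Rightarrow> 'b" assume "f \<in> {..<n} \<rightarrow>\<^sub>E UNIV"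
      then have "(\<lambda>i\<in>{..<n}. f i) = f"
        by (rule PiE_restrict)
      then show "\<exists>P. degree P \<le> 0 \<and> (\<forall>t. A (\<lambda>i\<in>{..<n}. if i < 0 then x + s t u else f i) = poly P t)"
        by (intro exI[of _ "[:A f:]"]) simp
    qed
  next
    case (Suc m)
    show ?case
    proof
      fix f :: "nat \<Rightarrow> 'b" assume f: "f \<in> {..<n} \<rightarrow>\<^sub>E UNIV"
      define g where "g t f = (\<lambda>i\<in>{..<n}. if i < m then x + s t u else f i)" for t and f :: "nat \<Rightarrow> 'b"
      have upd: "f(m := v) \<in> {..<n} \<rightarrow>\<^sub>E UNIV" for v
        using f Suc.prems by (auto simp: PiE_iff extensional_def)
      have IH: "\<exists>P. degree P \<le> m \<and> (\<forall>t. A (g t (f(m := v))) = poly P t)" for v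
        unfolding g_def using Suc.IH Suc.prems upd by (meson Suc_leD)
      obtain P where P: "degree P \<le> m" "\<And>t. A (g t (f(m := x))) = poly P t"
        using IH by blast
      obtain Q where Q: "degree Q \<le> m" "\<And>t. A (g t (f(m := u))) = poly Q t"
        using IH by blast
      have gupd: "g t (f(m := v)) = (g t f)(m := v)" for t v
        using Suc.prems by (auto simp: g_def)
      have "A (\<lambda>i\<in>{..<n}. if i < Suc m then x + s t u else f i) = poly (P + pCons 0 Q) t" for t
      proof -
        have "g t f \<in> {..<n} \<rightarrow>\<^sub>E UNIV"
          by (simp add: g_def)
        then have "linear_on s (*) UNIV (\<lambda>v. A ((g t f)(m := v)))"
          using A Suc.prems unfolding multilinear_on_def by simp
        then have "A ((g t f)(m := x + s t u)) = A ((g t f)(m := x)) + t * A ((g t f)(m := u))"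
          by (simp add: linear_on_def)
        moreover have "(\<lambda>i\<in>{..<n}. if i < Suc m then x + s t u else f i) = (g t f)(m := x + s t u)"
          using Suc.prems by (auto simp: g_def)
        ultimately show ?thesis
          using P(2) Q(2) by (simp add: gupd)
      qed
      moreover have "degree (P + pCons 0 Q) \<le> Suc m"
        using P(1) Q(1) by (intro degree_add_le) (auto intro: order_trans[OF degree_pCons_le])
      ultimately show "\<exists>P. degree P \<le> Suc m \<and>
          (\<forall>t. A (\<lambda>i\<in>{..<n}. if i < Suc m then x + s t u else f i) = poly P t)"
        by blast
    qed
  qed
  have "(\<lambda>i\<in>{..<n}. x) \<in> {..<n} \<rightarrow>\<^sub>E UNIV"
    by simp
  then obtain P where "degree P \<le> n"
    "\<And>t. A (\<lambda>i\<in>{..<n}. if i < n then x + s t u else (\<lambda>i\<in>{..<n}. x) i) = poly P t"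
    using ex[OF order_refl] by blast
  moreover have "(\<lambda>i\<in>{..<n}. if i < n then x + s t u else (\<lambda>i\<in>{..<n}. x) i) = diag n (x + s t u)" for t
    by (auto simp: diag_def)
  ultimately show ?thesis
    using that by metis
qed

definition lagrange_basis :: "nat \<Rightarrow> nat \<Rightarrow> 'k::field_char_0 poly"
  where "lagrange_basis n i =
    (\<Prod>j\<in>{..n} - {i}. smult (inverse (of_nat i - of_nat j)) [:- of_nat j, 1:])"

lemma poly_lagrange_basis:
  assumes "i \<le> n" "k \<le> n"
  shows "poly (lagrange_basis n i) (of_nat k :: 'k::field_char_0) = (if k = i then 1 else 0)"
proof (cases "k = i")
  case False
  then show ?thesis
    using assms by (auto simp: lagrange_basis_def poly_prod intro!: prod_zero bexI[of _ k])
next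
  case True
  have "poly (smult (inverse (of_nat i - of_nat j)) [:- of_nat j, 1:]) (of_nat i :: 'k) = 1"
    if "j \<noteq> i" for j
  proof -
    have "of_nat i - of_nat j \<noteq> (0 :: 'k)"
      using that by simp
    then have "inverse (of_nat i - of_nat j) * (of_nat i - of_nat j :: 'k) = 1"
      by (rule left_inverse)
    then show ?thesis
      by (simp add: algebra_simps)
  qed
  then show ?thesis
    unfolding lagrange_basis_def poly_prod True by (subst prod.neutral) auto
qed

lemma degree_lagrange_basis:
  assumes "i \<le> n"
  shows "degree (lagrange_basis n i :: 'k::field_char_0 poly) \<le> n"
proof -
  have "degree (lagrange_basis n i :: 'k poly) \<le>
      (\<Sum>j\<in>{..n} - {i}. degree (smult (inverse (of_nat i - of_nat j)) [:- of_nat j :: 'k, 1:]))"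
    unfolding lagrange_basis_def by (rule degree_prod_sum_le[unfolded o_def]) simp
  also have "\<dots> \<le> (\<Sum>j\<in>{..n} - {i}. 1)"
    by (intro sum_mono) (auto intro: order_trans[OF degree_smult_le])
  also have "\<dots> = n"
    using assms by simp
  finally show ?thesis .
qed

lemma lagrange_interpolation:
  fixes P :: "'k::field_char_0 poly"
  assumes "degree P \<le> n"
  shows "poly P t = (\<Sum>i\<le>n. poly (lagrange_basis n i) t * poly P (of_nat i))"
proof -
  define Q where "Q = (\<Sum>i\<le>n. smult (poly P (of_nat i)) (lagrange_basis n i))"
  have "degree Q \<le> n"
    unfolding Q_def
    by (intro degree_sum_le) (auto intro: order_trans[OF degree_smult_le] degree_lagrange_basis)
  moreover have "card (of_nat ` {..n} :: 'k set) = Suc n"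
    by (simp add: card_image inj_on_def)
  moreover have "poly P v = poly Q v" if "v \<in> of_nat ` {..n}" for v
  proof -
    from that obtain k where k: "v = of_nat k" "k \<le> n"
      by auto
    have "poly Q v = (\<Sum>i\<le>n. if k = i then poly P v else 0)"
      unfolding Q_def poly_sum by (intro sum.cong) (auto simp: k poly_lagrange_basis)
    then show ?thesis
      using k by simp
  qed
  ultimately have "P = Q"
    using assms by (intro poly_eqI_degree[of "of_nat ` {..n}"]) auto
  then have "poly P t = poly Q t"
    by simp
  then show ?thesis
    by (simp add: Q_def poly_sum mult.commute)
qed

text \<open>Every form restricted to a line is a polynomial of degree at most \<open>n\<close> in the parameter, hence
  determined by its values at \<open>0, \<dots>, n\<close>. Thus all powers on the line are combinations of \<open>n + 1\<close> fixed
  powers, with coefficients that depend continuously on \<open>t\<close>. This serves as a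
  substitute for polarization.\<close>

lemma tpow_line:
  fixes s :: "'k::real_normed_field \<Rightarrow> 'v::ab_group_add \<Rightarrow> 'v"
  shows "tpow s n (x + s t u) =
    (\<Sum>i\<le>n. tscale (poly (lagrange_basis n i) t) (tpow s n (x + s (of_nat i) u)))"
proof
  fix A :: "(nat \<Rightarrow> 'v) \<Rightarrow> 'k"
  show "tpow s n (x + s t u) A =
    (\<Sum>i\<le>n. tscale (poly (lagrange_basis n i) t) (tpow s n (x + s (of_nat i) u))) A"
  proof (cases "multilinear_on s n UNIV A")
    case True
    obtain P where P: "degree P \<le> n" "\<And>t. A (diag n (x + s t u)) = poly P t"
      using multilinear_on_line[OF True] by blast
    show ?thesis
      using True lagrange_interpolation[OF P(1), of t]
      by (simp add: sum_fun_apply tscale_apply tpow_def elem_tensor_def P(2))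
  qed (simp add: sum_fun_apply tscale_apply tpow_def elem_tensor_def)
qed

section \<open>Tensor norms\<close>

lemma s_tensor_norm_normed:
  assumes "s_tensor_norm s n \<alpha>" "normed_vs s V N"
  shows "normed_vs tscale (sym_tensors s n V) (\<alpha> V N)"
proof -
  have "normed_space tscale (sym_tensors s n V) (\<alpha> V N)"
    using assms(1) normed_vs.normed[OF assms(2)] unfolding s_tensor_norm_def by blast
  then show ?thesis
    by (intro normed_vs.intro normed_vs_axioms.intro vector_space_tscale)
qed

lemma s_tensor_norm_tpow_le:
  assumes "s_tensor_norm s n \<alpha>" "normed_vs s V N" "x \<in> V"
  shows "\<alpha> V N (tpow s n x) \<le> N x ^ n"
proof -
  interpret normed_vs s V N by fact
  have "\<alpha> V N (tpow s n x) \<le> pi_s s n V N (tpow s n x)"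
    using assms(1) normed tpow_in_sym_tensors[OF assms(3)] unfolding s_tensor_norm_def by blast
  also have "\<dots> \<le> N x ^ n"
    unfolding pi_s_def
  proof (rule cInf_lower)
    have "is_rep s n V (tpow s n x) (Suc 0) (\<lambda>_. 1) (\<lambda>_. x)"
      using assms(3) by (simp add: is_rep_def)
    moreover have "N x ^ n = (\<Sum>j<Suc 0. norm (1 :: 'a) * N x ^ n)"
      by simp
    ultimately show "N x ^ n \<in> {\<Sum>j<r. norm (c j) * N (y j) ^ n |r c y. is_rep s n V (tpow s n x) r c y}"
      by (intro CollectI exI[of _ "Suc 0"] exI[of _ "\<lambda>_. 1"] exI[of _ "\<lambda>_. x"] conjI)
    show "bdd_below {\<Sum>j<r. norm (c j) * N (y j) ^ n |r c y. is_rep s n V (tpow s n x) r c y}"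
      by (rule bdd_belowI[of _ 0])
        (auto simp: is_rep_def intro!: sum_nonneg mult_nonneg_nonneg zero_le_power)
  qed
  finally show ?thesis .
qed

text \<open>Continuity of \<open>T\<close> and of its tensor power makes both values of \<^const>\<open>op_norm\<close>
  true bounds, so the inequality between them becomes an estimate at each tensor.\<close>

lemma s_tensor_norm_mapping:
  assumes \<alpha>: "s_tensor_norm s n \<alpha>" and V: "normed_vs s V N" and W: "normed_vs s W M"
    and T: "linear_on s s V T" "T \<in> V \<rightarrow> W" "C \<ge> 0" "\<And>x. x \<in> V \<Longrightarrow> M (T x) \<le> C * N x"
    and z: "z \<in> sym_tensors s n V"
  shows "\<alpha> W M (sym_map s n V T z) \<le> C ^ n * \<alpha> V N z"
proof -
  note TV = s_tensor_norm_normed[OF \<alpha> V] and TW = s_tensor_norm_normed[OF \<alpha> W]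
  note cT = cont_linearI[OF V W T]
  have sym: "cont_linear tscale (sym_tensors s n V) (\<alpha> V N) (sym_tensors s n W) (\<alpha> W M) (sym_map s n V T)"
    "op_norm (sym_tensors s n V) (\<alpha> V N) (\<alpha> W M) (sym_map s n V T) \<le> op_norm V N M T ^ n"
    using \<alpha> normed_vs.normed[OF V] normed_vs.normed[OF W] cT(1) unfolding s_tensor_norm_def by blast+
  have "op_norm V N M T \<ge> 0"
    using op_norm_bound(1)[OF V W T(1)] cT(1) unfolding cont_linear_def by blast
  then have "op_norm V N M T ^ n \<le> C ^ n"
    using cT(2) by (rule power_mono[rotated])
  then have le: "op_norm (sym_tensors s n V) (\<alpha> V N) (\<alpha> W M) (sym_map s n V T) \<le> C ^ n"
    using sym(2) by linarith
  have "\<alpha> W M (sym_map s n V T z) \<le>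
      op_norm (sym_tensors s n V) (\<alpha> V N) (\<alpha> W M) (sym_map s n V T) * \<alpha> V N z"
    using op_norm_bound(2)[OF TV TW] sym(1) z unfolding cont_linear_def by blast
  also have "\<dots> \<le> C ^ n * \<alpha> V N z"
    using le normed_vs.nrm_nonneg[OF TV z] by (rule mult_right_mono)
  finally show ?thesis .
qed

lemma s_tensor_norm_subspace_le:
  assumes \<alpha>: "s_tensor_norm s n \<alpha>" and V: "normed_vs s V N" and D: "normed_vs s D N" "D \<subseteq> V"
    and z: "z \<in> sym_tensors s n D"
  shows "\<alpha> V N z \<le> \<alpha> D N z"
proof -
  interpret D: normed_vs s D N by fact
  have id: "linear_on s s D (\<lambda>x. x)"
    by (simp add: linear_on_def)
  obtain r c x where rep: "is_rep s n D z r c x"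
    using is_rep_exists[OF z] by metis
  have "sym_map s n D (\<lambda>x. x) z = z"
    using sym_map_rep[OF D.vector_space_axioms D.sub id rep] rep by (simp add: is_rep_def)
  then show ?thesis
    using s_tensor_norm_mapping[OF \<alpha> D(1) V id _ _ _ z, of 1] D(2) by auto
qed

text \<open>Write \<open>y k = x + t u\<close> with \<open>t\<close> the distance and \<open>u\<close> in the unit ball. By interpolation
  along this line the difference of the two powers is a combination of powers of vectors of norm at most
  \<open>N x + n\<close> with coefficients that tend to 0 with \<open>t\<close>, and \<open>\<alpha> \<le> \<pi>\<^sub>s\<close> bounds these powers.\<close>

lemma s_tensor_norm_tpow_tendsto:
  fixes s :: "'k::scalar_field \<Rightarrow> 'v::ab_group_add \<Rightarrow> 'v"
  assumes \<alpha>: "s_tensor_norm s n \<alpha>" and V: "normed_vs s V N"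
    and y: "\<And>k. y k \<in> V" and x: "x \<in> V" and lim: "(\<lambda>k. N (y k - x)) \<longlonglongrightarrow> 0"
  shows "(\<lambda>k. \<alpha> V N (tpow s n (y k) - tpow s n x)) \<longlonglongrightarrow> 0"
proof -
  interpret normed_vs s V N by fact
  interpret S: normed_vs tscale "sym_tensors s n V" "\<alpha> V N"
    by (rule s_tensor_norm_normed[OF \<alpha> V])
  let ?l = "\<lambda>i t. poly (lagrange_basis n i) t :: 'k"
  define t :: "nat \<Rightarrow> 'k" where "t k = of_real (N (y k - x))" for k
  \<comment> \<open>For \<open>y k = x\<close> the convention \<open>inverse 0 = 0\<close> gives \<open>u k = 0\<close>, which is right as well.\<close>
  define u where "u k = s (inverse (t k)) (y k - x)" for k
  have d: "y k - x \<in> V" for k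
    using y x by simp
  have uV: "u k \<in> V" for k
    using d by (simp add: u_def)
  have yk: "y k = x + s (t k) (u k)" for k
  proof (cases "N (y k - x) = 0")
    case True
    then show ?thesis
      using nrm_eq_0[OF d] by (simp add: u_def t_def)
  next
    case False
    then show ?thesis
      by (simp add: u_def t_def)
  qed
  have Nu: "N (u k) \<le> 1" for k
  proof -
    have "N (u k) = inverse (N (y k - x)) * N (y k - x)"
      unfolding u_def nrm_scale[OF d] using nrm_nonneg[OF d[of k]] by (simp add: t_def norm_inverse)
    then show ?thesis
      by (cases "N (y k - x) = 0") simp_all
  qed
  have node: "x + s (of_nat i) (u k) \<in> V" for i k
    using x uV by simp
  have bound: "\<alpha> V N (tpow s n (x + s (of_nat i) (u k))) \<le> (N x + real n) ^ n" if "i \<le> n" for i k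
  proof -
    have "N (x + s (of_nat i) (u k)) \<le> N x + real i * N (u k)"
      using nrm_add[OF x, of "s (of_nat i) (u k)"] uV by (simp add: nrm_scale)
    also have "\<dots> \<le> N x + real n * 1"
      using that Nu uV by (intro add_left_mono mult_mono) auto
    finally have "N (x + s (of_nat i) (u k)) ^ n \<le> (N x + real n) ^ n"
      using node by (intro power_mono) auto
    then show ?thesis
      using s_tensor_norm_tpow_le[OF \<alpha> V node, of i k] by linarith
  qed
  have le: "\<alpha> V N (tpow s n (y k) - tpow s n x) \<le>
      (\<Sum>i\<le>n. norm (?l i (t k) - ?l i 0) * (N x + real n) ^ n)" for k
  proof -
    have "tpow s n x = tpow s n (x + s 0 (u k))"
      by simp
    also have "\<dots> = (\<Sum>i\<le>n. tscale (?l i 0) (tpow s n (x + s (of_nat i) (u k))))"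
      by (rule tpow_line)
    finally have diff: "tpow s n (y k) - tpow s n x =
        (\<Sum>i\<le>n. tscale (?l i (t k) - ?l i 0) (tpow s n (x + s (of_nat i) (u k))))"
      using tpow_line[of s n x "t k" "u k"]
      by (simp add: yk[of k] tensor.scale_left_diff_distrib sum_subtractf)
    have "\<alpha> V N (tpow s n (y k) - tpow s n x) \<le>
        (\<Sum>i\<le>n. \<alpha> V N (tscale (?l i (t k) - ?l i 0) (tpow s n (x + s (of_nat i) (u k)))))"
      unfolding diff by (intro S.nrm_sum S.mem tpow_in_sym_tensors node)
    also have "\<dots> \<le> (\<Sum>i\<le>n. norm (?l i (t k) - ?l i 0) * (N x + real n) ^ n)"
      using bound by (intro sum_mono) (simp add: S.nrm_scale tpow_in_sym_tensors node mult_left_mono)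
    finally show ?thesis .
  qed
  have "t \<longlonglongrightarrow> of_real 0"
    unfolding t_def using lim by (rule tendsto_of_real)
  then have "(\<lambda>k. \<Sum>i\<le>n. norm (?l i (t k) - ?l i 0) * (N x + real n) ^ n) \<longlonglongrightarrow>
      (\<Sum>i\<le>n. norm (?l i 0 - ?l i 0) * (N x + real n) ^ n)"
    by (intro tendsto_intros) simp_all
  then have "(\<lambda>k. \<Sum>i\<le>n. norm (?l i (t k) - ?l i 0) * (N x + real n) ^ n) \<longlonglongrightarrow> 0"
    by simp
  then show ?thesis
    by (rule tendsto_sandwich[OF _ _ tendsto_const, rotated 2])
      (use le y x in \<open>auto intro!: always_eventually S.nrm_nonneg S.mem tpow_in_sym_tensors\<close>)
qed

section \<open>The Density Lemma\<close>

lemma cont_hom_poly_tendsto: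
  assumes V: "normed_vs s V N" and p: "cont_hom_poly s n V N p"
    and y: "\<And>k. y k \<in> V" and x: "x \<in> V" and lim: "(\<lambda>k. N (y k - x)) \<longlonglongrightarrow> 0"
  shows "(\<lambda>k. p (y k)) \<longlonglongrightarrow> p x"
proof -
  interpret normed_vs s V N by fact
  obtain A where A: "continuous_map (product_topology (\<lambda>_. norm_topology V N) {..<n}) euclidean A"
    "\<And>x. x \<in> V \<Longrightarrow> p x = A (diag n x)"
    using p unfolding cont_hom_poly_def by blast
  have "continuous_map (norm_topology V N) (product_topology (\<lambda>_. norm_topology V N) {..<n}) (diag n)"
    unfolding continuous_map_componentwise by (auto simp: diag_def extensional_def)
  then have "continuous_map (norm_topology V N) euclidean (A \<circ> diag n)"
    using A(1) by (rule continuous_map_compose)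
  then have cont: "continuous_map (norm_topology V N) (norm_topology UNIV norm) (A \<circ> diag n)"
    by (simp only: norm_topology_scalars)
  show ?thesis
  proof (rule LIMSEQ_I)
    fix e :: real assume "e > 0"
    then obtain d where d: "d > 0" "\<And>y. y \<in> V \<Longrightarrow> N (x - y) < d \<Longrightarrow> norm (p x - p y) < e"
      using cont[unfolded continuous_map_norm_topology[OF V normed_vs_scalars]] x A(2) by fastforce
    obtain m where m: "\<And>k. k \<ge> m \<Longrightarrow> N (y k - x) < d"
      using LIMSEQ_D[OF lim d(1)] y x by auto
    then show "\<exists>m. \<forall>k\<ge>m. norm (p (y k) - p x) < e"
      using d(2)[OF y] nrm_commute[OF x y] by (metis norm_minus_commute)
  qed
qed

locale dense_subspace = normed_vs_complete_field s E N
  for s :: "'k::scalar_field \<Rightarrow> 'v::ab_group_add \<Rightarrow> 'v" and E N +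
  fixes D :: "'v set" and n :: nat and \<alpha> :: "('v, 'k) norm_assignment"
  assumes D_sub: "subspace D" and D_le: "D \<subseteq> E" and D_dense: "norm_topology E N closure_of D = E"
    and alpha: "s_tensor_norm s n \<alpha>"
begin

sublocale D: normed_vs s D N
  by unfold_locales (rule normed_subspace[OF D_sub D_le])

sublocale SE: normed_vs tscale "sym_tensors s n E" "\<alpha> E N"
  by (rule s_tensor_norm_normed[OF alpha normed_vs_axioms])

sublocale SD: normed_vs tscale "sym_tensors s n D" "\<alpha> D N"
  by (rule s_tensor_norm_normed[OF alpha D.normed_vs_axioms])

lemma D_in_E: "x \<in> D \<Longrightarrow> x \<in> E"
  using D_le by blast

lemma approximating_sequence:
  assumes "x \<in> E"
  obtains y where "\<And>k. y k \<in> D" "(\<lambda>k. N (y k - x)) \<longlonglongrightarrow> 0"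
proof -
  have "\<forall>k. \<exists>y\<in>D. N (x - y) < 1 / real (Suc k)"
    using D_dense assms unfolding dense_iff
    by (meson IntD1 of_nat_0_less_iff zero_less_Suc zero_less_divide_1_iff)
  then obtain y where y: "\<And>k. y k \<in> D" "\<And>k. N (x - y k) < 1 / real (Suc k)"
    by metis
  have yE: "y k \<in> E" for k
    using y(1) D_in_E by blast
  have le: "N (y k - x) \<le> 1 / real (Suc k)" for k
    using y(2)[of k] nrm_commute[OF yE assms, of k] by simp
  show ?thesis
  proof (rule that[OF y(1)])
    show "(\<lambda>k. N (y k - x)) \<longlonglongrightarrow> 0"
      by (rule tendsto_sandwich[OF _ _ tendsto_const LIMSEQ_Suc[OF lim_1_over_n]])
        (use le yE assms in \<open>auto intro!: always_eventually\<close>)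
  qed
qed

text \<open>Move \<open>z\<close> into \<open>D\<close> by maps \<open>R k\<close> with \<open>\<parallel>R k x - x\<parallel> \<le> \<parallel>x\<parallel> / (k + 1)\<close> and let \<open>k\<close>
  tend to infinity: the values of \<open>\<phi>\<close> converge to \<open>\<phi> z\<close>, and the factors \<open>(1 + 1 / (k + 1)) ^ n\<close> of the
  norms converge to 1.\<close>

lemma bound_of_finite_dim:
  fixes p :: "'v \<Rightarrow> 'k" and \<phi> :: "('v, 'k) tensor \<Rightarrow> 'k"
  assumes \<phi>: "\<And>z r c x. is_rep s n E z r c x \<Longrightarrow> \<phi> z = (\<Sum>j<r. c j * p (x j))"
    and p: "\<And>x y. (\<And>k. y k \<in> E) \<Longrightarrow> x \<in> E \<Longrightarrow> (\<lambda>k. N (y k - x)) \<longlonglongrightarrow> 0 \<Longrightarrow>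
      (\<lambda>k. p (y k)) \<longlonglongrightarrow> p x"
    and K: "K \<ge> 0" "\<And>z. z \<in> sym_tensors s n D \<Longrightarrow> norm (\<phi> z) \<le> K * \<alpha> D N z"
    and M: "M \<in> FIN s E" and z: "z \<in> sym_tensors s n M"
  shows "norm (\<phi> z) \<le> K * \<alpha> M N z"
proof -
  have ME: "subspace M" "M \<subseteq> E"
    using M by (auto simp: FIN_def)
  interpret M: normed_vs s M N
    by unfold_locales (rule normed_subspace[OF ME])
  obtain r c x where rep: "is_rep s n M z r c x"
    using is_rep_exists[OF z] by metis
  have xM: "x j \<in> M" if "j < r" for j
    using rep that by (simp add: is_rep_def)
  define e where "e k = 1 / real (Suc k)" for k
  have e_pos: "e k > 0" for k
    by (simp add: e_def)
  have e_lim: "e \<longlonglongrightarrow> 0"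
    unfolding e_def by (rule LIMSEQ_Suc[OF lim_1_over_n])
  have "\<forall>k. \<exists>R. linear_on s s M R \<and> R \<in> M \<rightarrow> D \<and> (\<forall>x\<in>M. N (R x - x) \<le> e k * N x)"
    using push_into_dense_subspace[OF D_sub D_le D_dense M e_pos] by metis
  then obtain R where R: "\<And>k. linear_on s s M (R k)" "\<And>k. R k \<in> M \<rightarrow> D"
    "\<And>k x. x \<in> M \<Longrightarrow> N (R k x - x) \<le> e k * N x"
    by metis
  have RD: "R k v \<in> D" if "v \<in> M" for k v
    using R(2) that by blast
  define w where "w k = sym_map s n M (R k) z" for k
  have w: "is_rep s n D (w k) r c (\<lambda>j. R k (x j))" for k
    using sym_map_rep[OF vector_space_axioms ME(1) R(1) rep, of k] RD xM
    by (simp add: is_rep_def w_def)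
  have "(\<lambda>k. p (R k (x j))) \<longlonglongrightarrow> p (x j)" if "j < r" for j
  proof (rule p)
    show "R k (x j) \<in> E" for k
      using D_in_E RD xM that by blast
    show xE: "x j \<in> E"
      using ME(2) xM that by blast
    have "(\<lambda>k. e k * N (x j)) \<longlonglongrightarrow> 0 * N (x j)"
      by (intro tendsto_intros e_lim)
    then have lim: "(\<lambda>k. e k * N (x j)) \<longlonglongrightarrow> 0"
      by simp
    show "(\<lambda>k. N (R k (x j) - x j)) \<longlonglongrightarrow> 0"
    proof (rule tendsto_sandwich[OF _ _ tendsto_const lim]; intro always_eventually allI)
      show "0 \<le> N (R k (x j) - x j)" for k
        using D_in_E[OF RD[OF xM[OF that]]] xE by (intro nrm_nonneg mem)
      show "N (R k (x j) - x j) \<le> e k * N (x j)" for k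
        using R(3) xM that by blast
    qed
  qed
  then have "(\<lambda>k. \<Sum>j<r. c j * p (R k (x j))) \<longlonglongrightarrow> (\<Sum>j<r. c j * p (x j))"
    by (intro tendsto_sum tendsto_mult tendsto_const) simp
  then have "(\<lambda>k. \<phi> (w k)) \<longlonglongrightarrow> \<phi> z"
    using \<phi>[OF is_rep_mono[OF w D_le]] \<phi>[OF is_rep_mono[OF rep ME(2)]] by simp
  then have lim1: "(\<lambda>k. norm (\<phi> (w k))) \<longlonglongrightarrow> norm (\<phi> z)"
    by (rule tendsto_norm)
  have "(\<lambda>k. K * ((1 + e k) ^ n * \<alpha> M N z)) \<longlonglongrightarrow> K * ((1 + 0) ^ n * \<alpha> M N z)"
    by (intro tendsto_intros e_lim)
  then have lim2: "(\<lambda>k. K * ((1 + e k) ^ n * \<alpha> M N z)) \<longlonglongrightarrow> K * \<alpha> M N z"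
    by simp
  have "norm (\<phi> (w k)) \<le> K * ((1 + e k) ^ n * \<alpha> M N z)" for k
  proof -
    have "N (R k v) \<le> (1 + e k) * N v" if v: "v \<in> M" for v
      using nrm_le_diff[OF D_in_E[OF RD[OF v]], of v k] R(3)[OF v, of k] v ME(2)
      by (auto simp: distrib_right)
    then have "\<alpha> D N (w k) \<le> (1 + e k) ^ n * \<alpha> M N z"
      unfolding w_def using e_pos[of k]
      by (intro s_tensor_norm_mapping[OF alpha M.normed_vs_axioms D.normed_vs_axioms R(1,2) _ _ z]) auto
    then have "K * \<alpha> D N (w k) \<le> K * ((1 + e k) ^ n * \<alpha> M N z)"
      using K(1) by (rule mult_left_mono)
    then show ?thesis
      using K(2)[OF is_rep_in_sym_tensors[OF w], of k] by linarith
  qed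
  then show ?thesis
    by (intro LIMSEQ_le[OF lim1 lim2]) auto
qed

text \<open>Passing to the infimum requires that some \<open>M\<close> occurs; the span of the vectors in a
  representation of \<open>z\<close> does.\<close>

lemma bound_finitely_generated:
  fixes \<phi> :: "('v, 'k) tensor \<Rightarrow> 'k"
  assumes fg: "finitely_generated s n \<alpha>" and K: "K \<ge> 0"
    and bound: "\<And>M. M \<in> FIN s E \<Longrightarrow> z \<in> sym_tensors s n M \<Longrightarrow> norm (\<phi> z) \<le> K * \<alpha> M N z"
    and z: "z \<in> sym_tensors s n E"
  shows "norm (\<phi> z) \<le> K * \<alpha> E N z"
proof -
  let ?A = "{\<alpha> M N z |M. M \<in> FIN s E \<and> z \<in> sym_tensors s n M}"
  have Inf: "\<alpha> E N z = Inf ?A"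
    using fg normed z unfolding finitely_generated_def by blast
  obtain r c x where rep: "is_rep s n E z r c x"
    using is_rep_exists[OF z] by metis
  define M where "M = span (x ` {..<r})"
  have "x ` {..<r} \<subseteq> E"
    using rep by (auto simp: is_rep_def)
  then have "M \<in> FIN s E"
    unfolding FIN_def finite_dim_def M_def using span_minimal[OF _ sub] by blast
  moreover have "is_rep s n M z r c x"
    using rep by (auto simp: is_rep_def M_def intro: span_base)
  ultimately have ne: "?A \<noteq> {}"
    using is_rep_in_sym_tensors by blast
  show ?thesis
  proof (cases "K = 0")
    case True
    obtain M where "M \<in> FIN s E" "z \<in> sym_tensors s n M"
      using ne by blast
    then show ?thesis
      using bound[of M] True by simp
  next
    case False
    then have "K > 0"
      using K by simp
    have "norm (\<phi> z) / K \<le> Inf ?A"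
    proof (rule cInf_greatest[OF ne])
      fix a assume "a \<in> ?A"
      then obtain M where "a = \<alpha> M N z" "M \<in> FIN s E" "z \<in> sym_tensors s n M"
        by blast
      then show "norm (\<phi> z) / K \<le> a"
        using bound[of M] \<open>K > 0\<close> by (simp add: field_simps)
    qed
    then show ?thesis
      unfolding Inf using \<open>K > 0\<close> by (simp add: field_simps)
  qed
qed

text \<open>A quotient map \<open>Q\<close> of \<open>D\<close> extends to a contraction \<open>T\<close> on \<open>E\<close> with the same
  finite-dimensional, hence complete, codomain. The tensor powers of \<open>Q\<close> and \<open>T\<close> agree at \<open>z\<close>, and that of
  \<open>T\<close> does not increase the norm.\<close>

lemma cofinitely_generated_dense_le:
  assumes cg: "cofinitely_generated s n \<alpha>" and z: "z \<in> sym_tensors s n D"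
  shows "\<alpha> D N z \<le> \<alpha> E N z"
proof -
  let ?A = "{\<alpha> (quot_space s D L) (quot_norm N L) (sym_map s n D (quot_map s D L) z) |L. L \<in> COFIN s D N}"
  have "\<alpha> D N z = Sup ?A"
    using cg D.normed z unfolding cofinitely_generated_def by blast
  also have "\<dots> \<le> \<alpha> E N z"
  proof (rule cSup_least)
    show "?A \<noteq> {}"
      using D.whole_space_in_COFIN by blast
    fix a assume "a \<in> ?A"
    then obtain L where L: "L \<in> COFIN s D N"
      and a: "a = \<alpha> (quot_space s D L) (quot_norm N L) (sym_map s n D (quot_map s D L) z)"
      by blast
    let ?W = "quot_space s D L" and ?M = "quot_norm N L" and ?Q = "quot_map s D L"
    have sL: "subspace L" "L \<subseteq> D"
      using L by (auto simp: COFIN_def)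
    interpret W: normed_vs_complete_field s ?W ?M
      by unfold_locales (rule D.normed_quot_space[OF L])
    have "complete_norm ?W ?M"
      using L by (intro W.complete_finite_dim) (auto simp: COFIN_def)
    moreover have Q: "linear_on s s D ?Q" "?Q \<in> D \<rightarrow> ?W" "\<And>x. x \<in> D \<Longrightarrow> ?M (?Q x) \<le> N x"
      using D.linear_on_quot_map[OF sL] D.quot_map(1)[OF sL] D.quot_norm_quot_map[OF sL] by auto
    ultimately obtain T where T: "linear_on s s E T" "T \<in> E \<rightarrow> ?W" "\<And>x. x \<in> E \<Longrightarrow> ?M (T x) \<le> N x"
      "\<And>x. x \<in> D \<Longrightarrow> T x = ?Q x"
      using extend_contraction[OF normed_vs_axioms W.normed_vs_axioms _ D_sub D_le D_dense] by metis
    obtain r c x where rep: "is_rep s n D z r c x"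
      using is_rep_exists[OF z] by metis
    have "sym_map s n D ?Q z = sym_map s n E T z"
      unfolding sym_map_rep[OF vector_space_axioms D_sub Q(1) rep]
        sym_map_rep[OF vector_space_axioms sub T(1) is_rep_mono[OF rep D_le]]
      using rep T(4) by (intro sum.cong) (auto simp: is_rep_def)
    moreover have "\<alpha> ?W ?M (sym_map s n E T z) \<le> 1 ^ n * \<alpha> E N z"
      using T(3) z sym_tensors_mono[OF D_le, of s n]
      by (intro s_tensor_norm_mapping[OF alpha normed_vs_axioms W.normed_vs_axioms T(1,2)]) auto
    ultimately show "a \<le> \<alpha> E N z"
      by (simp add: a)
  qed
  finally show ?thesis .
qed

text \<open>Approximate each vector in a representation of \<open>z\<close> from \<open>D\<close>. The resulting tensors converge to
  \<open>z\<close> with respect to \<open>\<alpha>\<close>, since taking powers is continuous, and their values under \<open>\<phi>\<close>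
  converge since \<open>p\<close> is continuous.\<close>

lemma bound_of_dense:
  fixes p :: "'v \<Rightarrow> 'k" and \<phi> :: "('v, 'k) tensor \<Rightarrow> 'k"
  assumes \<phi>: "\<And>z r c x. is_rep s n E z r c x \<Longrightarrow> \<phi> z = (\<Sum>j<r. c j * p (x j))"
    and p: "\<And>x y. (\<And>k. y k \<in> E) \<Longrightarrow> x \<in> E \<Longrightarrow> (\<lambda>k. N (y k - x)) \<longlonglongrightarrow> 0 \<Longrightarrow>
      (\<lambda>k. p (y k)) \<longlonglongrightarrow> p x"
    and K: "K \<ge> 0" "\<And>z. z \<in> sym_tensors s n D \<Longrightarrow> norm (\<phi> z) \<le> K * \<alpha> E N z"
    and z: "z \<in> sym_tensors s n E"
  shows "norm (\<phi> z) \<le> K * \<alpha> E N z"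
proof -
  obtain r c x where rep: "is_rep s n E z r c x"
    using is_rep_exists[OF z] by metis
  have xE: "x j \<in> E" if "j < r" for j
    using rep that by (simp add: is_rep_def)
  have "\<forall>j. \<exists>y. j < r \<longrightarrow> (\<forall>k. y k \<in> D) \<and> (\<lambda>k. N (y k - x j)) \<longlonglongrightarrow> 0"
    using approximating_sequence[OF xE] by metis
  then obtain y where y: "\<And>j k. j < r \<Longrightarrow> y j k \<in> D" "\<And>j. j < r \<Longrightarrow> (\<lambda>k. N (y j k - x j)) \<longlonglongrightarrow> 0"
    by metis
  have yE: "y j k \<in> E" if "j < r" for j k
    using y(1) that D_in_E by blast
  define w where "w k = (\<Sum>j<r. tscale (c j) (tpow s n (y j k)))" for k
  have w: "is_rep s n D (w k) r c (\<lambda>j. y j k)" for k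
    using y(1) by (simp add: is_rep_def w_def)
  have wE: "w k \<in> sym_tensors s n E" for k
    using is_rep_in_sym_tensors[OF is_rep_mono[OF w D_le]] .
  have "(\<lambda>k. \<Sum>j<r. c j * p (y j k)) \<longlonglongrightarrow> (\<Sum>j<r. c j * p (x j))"
    using p[OF yE xE y(2)] by (intro tendsto_sum tendsto_mult tendsto_const) simp
  then have "(\<lambda>k. \<phi> (w k)) \<longlonglongrightarrow> \<phi> z"
    using \<phi>[OF is_rep_mono[OF w D_le]] \<phi>[OF rep] by simp
  then have lim1: "(\<lambda>k. norm (\<phi> (w k))) \<longlonglongrightarrow> norm (\<phi> z)"
    by (rule tendsto_norm)
  let ?d = "\<lambda>k. \<Sum>j<r. norm (c j) * \<alpha> E N (tpow s n (y j k) - tpow s n (x j))"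
  have "?d \<longlonglongrightarrow> (\<Sum>j<r. norm (c j) * 0)"
    using s_tensor_norm_tpow_tendsto[OF alpha normed_vs_axioms yE xE y(2)]
    by (intro tendsto_sum tendsto_mult tendsto_const) simp
  then have "(\<lambda>k. K * (\<alpha> E N z + ?d k)) \<longlonglongrightarrow> K * (\<alpha> E N z + 0)"
    by (intro tendsto_intros) simp
  then have lim2: "(\<lambda>k. K * (\<alpha> E N z + ?d k)) \<longlonglongrightarrow> K * \<alpha> E N z"
    by simp
  have "norm (\<phi> (w k)) \<le> K * (\<alpha> E N z + ?d k)" for k
  proof -
    have diff: "tpow s n (y j k) - tpow s n (x j) \<in> sym_tensors s n E" if "j < r" for j
      using yE xE that by (intro SE.mem tpow_in_sym_tensors)
    have eq: "w k - z = (\<Sum>j<r. tscale (c j) (tpow s n (y j k) - tpow s n (x j)))"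
      using rep by (simp add: w_def is_rep_def tensor.scale_right_diff_distrib sum_subtractf)
    have "\<alpha> E N (w k - z) \<le> (\<Sum>j<r. \<alpha> E N (tscale (c j) (tpow s n (y j k) - tpow s n (x j))))"
      unfolding eq using diff by (intro SE.nrm_sum SE.mem(2)) simp
    also have "\<dots> = ?d k"
      using diff by (intro sum.cong) (simp_all add: SE.nrm_scale)
    finally have "\<alpha> E N (w k) \<le> \<alpha> E N z + ?d k"
      using SE.nrm_le_diff[OF wE z, of k] by linarith
    then have "K * \<alpha> E N (w k) \<le> K * (\<alpha> E N z + ?d k)"
      using K(1) by (rule mult_left_mono)
    then show ?thesis
      using K(2)[OF is_rep_in_sym_tensors[OF w], of k] by linarith
  qed
  then show ?thesis
    by (intro LIMSEQ_le[OF lim1 lim2]) auto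
qed

end

theorem lemma2p8:
  fixes s :: "'k::scalar_field \<Rightarrow> 'v::ab_group_add \<Rightarrow> 'v"
    and n :: nat
    and \<alpha> :: "('v, 'k) norm_assignment"
    and E E\<^sub>0 :: "'v set"
    and N :: "'v \<Rightarrow> real"
    and p :: "'v \<Rightarrow> 'k"
  assumes "vector_space s"
    and "s_tensor_norm s n \<alpha>"
    and "finitely_generated s n \<alpha> \<or> cofinitely_generated s n \<alpha>"
    and "normed_space s E N"
    and "module.subspace s E\<^sub>0" "E\<^sub>0 \<subseteq> E" "norm_topology E N closure_of E\<^sub>0 = E"
    and "cont_hom_poly s n E N p"
    and "in_dual tscale (sym_tensors s n E\<^sub>0) (\<alpha> E\<^sub>0 N) (poly_functional s n E p)"
  shows "in_dual tscale (sym_tensors s n E) (\<alpha> E N) (poly_functional s n E p) \<and>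
    op_norm (sym_tensors s n E) (\<alpha> E N) norm (poly_functional s n E p) =
    op_norm (sym_tensors s n E\<^sub>0) (\<alpha> E\<^sub>0 N) norm (poly_functional s n E p)"
proof -
  interpret dense_subspace s E N E\<^sub>0 n \<alpha>
    using assms by (intro dense_subspace.intro dense_subspace_axioms.intro
        normed_vs_complete_field.intro normed_vs.intro normed_vs_axioms.intro)
  define \<phi> where "\<phi> = poly_functional s n E p"
  let ?K = "op_norm (sym_tensors s n E\<^sub>0) (\<alpha> E\<^sub>0 N) norm \<phi>"
  obtain A where A: "multilinear_on s n E A" "\<And>x. x \<in> E \<Longrightarrow> p x = A (diag n x)"
    using assms(8) unfolding cont_hom_poly_def by blast
  obtain A' where A': "\<And>z. z \<in> sym_tensors s n E \<Longrightarrow> \<phi> z = z A'"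
    "\<And>z r c x. is_rep s n E z r c x \<Longrightarrow> z A' = (\<Sum>j<r. c j * p (x j))"
    unfolding \<phi>_def using form_functional[where f = p, OF assms(1) sub A] by metis
  have \<phi>_rep: "\<phi> z = (\<Sum>j<r. c j * p (x j))" if "is_rep s n E z r c x" for z r c x
    using A' that is_rep_in_sym_tensors[OF that] by simp
  have lin: "linear_on tscale (*) (sym_tensors s n E) \<phi>"
    unfolding linear_on_def by (auto simp: A' tscale_apply)
  have lin0: "linear_on tscale (*) (sym_tensors s n E\<^sub>0) \<phi>"
    and cont0: "continuous_map (norm_topology (sym_tensors s n E\<^sub>0) (\<alpha> E\<^sub>0 N)) (norm_topology UNIV norm) \<phi>"
    using assms(9) by (simp_all add: in_dual_def \<phi>_def norm_topology_scalars)
  note K = op_norm_bound[OF SD.normed_vs_axioms normed_vs_scalars lin0 cont0]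
  have lim: "(\<lambda>k. p (y k)) \<longlonglongrightarrow> p x"
    if "\<And>k. y k \<in> E" "x \<in> E" "(\<lambda>k. N (y k - x)) \<longlonglongrightarrow> 0" for x y
    using cont_hom_poly_tendsto[OF normed_vs_axioms assms(8) that] .
  have bound: "norm (\<phi> z) \<le> ?K * \<alpha> E N z" if z: "z \<in> sym_tensors s n E" for z
    using assms(3)
  proof
    assume fg: "finitely_generated s n \<alpha>"
    show ?thesis
    proof (rule bound_finitely_generated[OF fg K(1) _ z])
      show "norm (\<phi> z) \<le> ?K * \<alpha> M N z" if M: "M \<in> FIN s E" "z \<in> sym_tensors s n M" for M
        by (rule bound_of_finite_dim[where p = p, OF _ _ K M]) (use \<phi>_rep lim in blast)+
    qed
  next
    assume cg: "cofinitely_generated s n \<alpha>"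
    have "norm (\<phi> w) \<le> ?K * \<alpha> E N w" if w: "w \<in> sym_tensors s n E\<^sub>0" for w
      using K(2)[OF w] mult_left_mono[OF cofinitely_generated_dense_le[OF cg w] K(1)] by linarith
    then show ?thesis
      by (intro bound_of_dense[where p = p, OF _ _ K(1) _ z]) (use \<phi>_rep lim in blast)+
  qed
  have cont: "continuous_map (norm_topology (sym_tensors s n E) (\<alpha> E N)) (norm_topology UNIV norm) \<phi>"
    using bounded_linear_on_iff[OF SE.normed_vs_axioms normed_vs_scalars lin] bound K(1) by auto
  then have dual: "in_dual tscale (sym_tensors s n E) (\<alpha> E N) \<phi>"
    using lin by (simp add: in_dual_def norm_topology_scalars)
  have le: "op_norm (sym_tensors s n E) (\<alpha> E N) norm \<phi> \<le> ?K"
    using bound K(1) by (intro op_norm_le) auto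
  note K' = op_norm_bound[OF SE.normed_vs_axioms normed_vs_scalars lin cont]
  have "norm (\<phi> z) \<le> op_norm (sym_tensors s n E) (\<alpha> E N) norm \<phi> * \<alpha> E\<^sub>0 N z"
    if z: "z \<in> sym_tensors s n E\<^sub>0" for z
  proof -
    have "z \<in> sym_tensors s n E"
      using z sym_tensors_mono[OF D_le] by blast
    from K'(2)[OF this] show ?thesis
      using mult_left_mono[OF s_tensor_norm_subspace_le[OF alpha normed_vs_axioms D.normed_vs_axioms D_le z] K'(1)]
      by linarith
  qed
  then have "?K \<le> op_norm (sym_tensors s n E) (\<alpha> E N) norm \<phi>"
    using K'(1) by (intro op_norm_le) auto
  then show ?thesis
    using dual le unfolding \<phi>_def by simp
qed

end
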